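(* Let $\alpha\le 1$ and $g,h\in D_\alpha$. Suppose $g$ and $h$ admit analytic continuations to $\overline{\mathbb{D}}$ and have no zeros in $\mathbb{D}$. Define $f(z_1,z_2)=g(z_1)h(z_2)$. Then there exists a constant $C=C(g,h,\alpha)$ such that $$\operatorname{dist}^2_{\mathfrak{D}_\alpha}(1,f\cdot\mathfrak{P}_n)\le \frac{C}{\varphi_\alpha(n+1)}$$ for all sufficiently large $n$. Moreover, this estimate is sharp in the sense that if $h$ has at least one zero on $\mathbb{T}$ and $g$ has no zeros in the closed disk $\overline{\mathbb{D}}$ (or vice versa, with the roles of $g$ and $h$ exchanged), then there exists a constant $\tilde C=\tilde C(g,h,\alpha)>0$ such that $$\frac{\tilde C}{\varphi_\alpha(n+1)}\le \operatorname{dist}^2_{\mathfrak{D}_\alpha}(1,f\cdot\mathfrak{P}_n)$$ for all $n\ge 1$.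
   Context: $\mathbb{D}$ is the open unit disk in $\mathbb{C}$ and $\mathbb{T}$ the unit circle. For $\alpha\in\mathbb{R}$, $D_\alpha$ is the Hilbert space of analytic functions $g(z)=\sum_{k\ge0}a_kz^k$ on $\mathbb{D}$ with $\|g\|_{D_\alpha}^2=\sum_{k\ge 0}(k+1)^\alpha|a_k|^2<\infty$, and $\mathfrak{D}_\alpha$ is the Hilbert space of holomorphic functions $f(z_1,z_2)=\sum_{k,l\ge0}a_{k,l}z_1^kz_2^l$ on the bidisk $\mathbb{D}^2$ with $\|f\|_\alpha^2=\sum_{k,l\ge0}(k+1)^\alpha(l+1)^\alpha|a_{k,l}|^2<\infty$. For $n\ge1$, $\mathfrak{P}_n$ is the space of polynomials $\sum_{k=0}^n\sum_{l=0}^n c_{k,l}z_1^kz_2^l$, and $\operatorname{dist}_{\mathfrak{D}_\alpha}(1,f\cdot\mathfrak{P}_n)=\inf\{\|pf-1\|_\alpha: p\in\mathfrak{P}_n\}$. For $\alpha<1$, $\varphi_\alpha(s)=s^{1-\alpha}$, and $\varphi_1(s)=\log^+(s)=\max\{\log s,0\}$, for $s\in[0,\infty)$. A function "admits an analytic continuation to $\overline{\mathbb{D}}$" if it extends analytically to an open neighbourhood of $\overline{\mathbb{D}}$; zeros on $\mathbb{T}$ refer to this extension. *)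

theory Defs
  imports "HOL-Complex_Analysis.Complex_Analysis"
begin

text \<open>Functions on the disk and on the bidisk are total functions on \<^typ>\<open>complex\<close>, resp. curried
  functions of two complex variables; only their values on the open (bi)disk matter.\<close>

definition taylor_coeff :: "(complex \<Rightarrow> complex) \<Rightarrow> nat \<Rightarrow> complex" where
  "taylor_coeff g k = (deriv ^^ k) g 0 / fact k"

definition dirichlet_space :: "real \<Rightarrow> (complex \<Rightarrow> complex) set" where
  "dirichlet_space \<alpha> =
     {g. g holomorphic_on ball 0 1 \<and>
         summable (\<lambda>k. real (k + 1) powr \<alpha> * (cmod (taylor_coeff g k))\<^sup>2)}"

text \<open>The coefficient of \<open>z\<^sub>1\<^sup>k z\<^sub>2\<^sup>l\<close> of a function holomorphic on the bidisk, as the mixed partial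
  derivative at the origin divided by \<open>k! l!\<close>.\<close>

definition taylor_coeff2 :: "(complex \<Rightarrow> complex \<Rightarrow> complex) \<Rightarrow> nat \<Rightarrow> nat \<Rightarrow> complex" where
  "taylor_coeff2 f k l =
     (deriv ^^ k) (\<lambda>z1. (deriv ^^ l) (\<lambda>z2. f z1 z2) 0) 0 / (fact k * fact l)"

definition bidisk_holomorphic :: "(complex \<Rightarrow> complex \<Rightarrow> complex) \<Rightarrow> bool" where
  "bidisk_holomorphic f \<longleftrightarrow>
     (\<forall>z1\<in>ball 0 1. \<forall>z2\<in>ball 0 1.
        ((\<lambda>(k, l). taylor_coeff2 f k l * z1 ^ k * z2 ^ l) has_sum f z1 z2) UNIV)"

definition bidisk_dirichlet_space :: "real \<Rightarrow> (complex \<Rightarrow> complex \<Rightarrow> complex) set" where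
  "bidisk_dirichlet_space \<alpha> =
     {f. bidisk_holomorphic f \<and>
         (\<lambda>(k, l). real (k + 1) powr \<alpha> * real (l + 1) powr \<alpha> * (cmod (taylor_coeff2 f k l))\<^sup>2)
           summable_on UNIV}"

text \<open>Meaningful only on \<^const>\<open>bidisk_dirichlet_space\<close>: a divergent \<^const>\<open>infsum\<close> is \<open>0\<close>.\<close>

definition bidisk_norm :: "real \<Rightarrow> (complex \<Rightarrow> complex \<Rightarrow> complex) \<Rightarrow> real" where
  "bidisk_norm \<alpha> f =
     sqrt (\<Sum>\<^sub>\<infinity>(k, l)\<in>UNIV.
             real (k + 1) powr \<alpha> * real (l + 1) powr \<alpha> * (cmod (taylor_coeff2 f k l))\<^sup>2)"

definition bidisk_polys :: "nat \<Rightarrow> (complex \<Rightarrow> complex \<Rightarrow> complex) set" where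
  "bidisk_polys n = {\<lambda>z1 z2. \<Sum>k\<le>n. \<Sum>l\<le>n. c k l * z1 ^ k * z2 ^ l | c. True}"

text \<open>The distance from \<open>1\<close> to \<open>f\<close> times the polynomials of bidegree at most \<open>(n, n)\<close>. It is used only
  for \<open>f\<close> in \<^term>\<open>bidisk_dirichlet_space \<alpha>\<close>; there multiplication by polynomials preserves the
  space, so all the norms below are genuine.\<close>

definition dist_one :: "real \<Rightarrow> (complex \<Rightarrow> complex \<Rightarrow> complex) \<Rightarrow> nat \<Rightarrow> real" where
  "dist_one \<alpha> f n = (INF p\<in>bidisk_polys n. bidisk_norm \<alpha> (\<lambda>z1 z2. p z1 z2 * f z1 z2 - 1))"

text \<open>Only used for \<open>\<alpha> \<le> 1\<close>.\<close>

definition phi :: "real \<Rightarrow> real \<Rightarrow> real" where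
  "phi \<alpha> s = (if \<alpha> < 1 then s powr (1 - \<alpha>) else max (ln s) 0)"

text \<open>\<open>G\<close> is an analytic continuation of \<open>g\<close> to (a neighbourhood of) the closed disk; \<open>G\<close> is
  determined by \<open>g\<close> on the closed disk.\<close>

definition closed_disk_continuation :: "(complex \<Rightarrow> complex) \<Rightarrow> (complex \<Rightarrow> complex) \<Rightarrow> bool" where
  "closed_disk_continuation g G \<longleftrightarrow>
     (\<exists>U. open U \<and> cball 0 1 \<subseteq> U \<and> G holomorphic_on U) \<and> (\<forall>z\<in>ball 0 1. G z = g z)"

end

theory Submission
  imports Defs "HOL-Real_Asymp.Real_Asymp"
begin

text \<open>
  Write \<open>w k = (k + 1) powr \<alpha>\<close> and \<open>S N = (\<Sum>k\<le>N. 1 / w k)\<close>, which is comparable to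
  \<open>phi \<alpha> (N + 1)\<close>. Factor \<open>g = q u\<close>, where \<open>q\<close> is a polynomial with all its zeros on the circle and
  \<open>u\<close> has no zero in the closed disk.

  Upper bound: for \<open>\<zeta>\<close> on the circle let \<open>r\<^sub>\<zeta>\<close> be the normalised reproducing kernel, with coefficients
  \<open>\<zeta>\<^sup>-\<^sup>k / (w k S N)\<close> for \<open>k \<le> N\<close>. As \<open>r\<^sub>\<zeta>\<close> takes the value \<open>1\<close> at \<open>\<zeta>\<close>, the polynomial \<open>1 - r\<^sub>\<zeta>\<close> is a multiple of
  \<open>z - \<zeta>\<close>; multiplying these quotients over all zeros of \<open>q\<close>, and by a Taylor polynomial of \<open>1 / u\<close>,
  gives \<open>p\<close> with \<open>p g = 1 + E\<close>. All error terms have bounded coefficient sum and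
  \<open>w k |E\<^sub>k| = O(1 / S N)\<close>. These two bounds are preserved by products, because
  \<open>w (i + j) \<le> w i + w j\<close> for \<open>\<alpha> \<le> 1\<close>, and together they give \<open>\<parallel>E\<parallel>\<^sup>2 = O(1 / S N)\<close>. In two variables
  take \<open>p\<^sub>1 (z\<^sub>1) p\<^sub>2 (z\<^sub>2)\<close>.

  Lower bound: put one variable equal to \<open>0\<close> and multiply \<open>p h - 1\<close> by \<open>1 / u\<close>, a bounded operation.
  The result is \<open>p q - 1 / u\<close>; truncated at a degree \<open>D\<close> beyond that of \<open>p q\<close> and evaluated at a zero of
  \<open>q\<close> it is a partial sum of \<open>- 1 / u\<close>, which stays away from \<open>0\<close>, while by Cauchy-Schwarz the square
  of its modulus is at most \<open>S D\<close> times the squared norm.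
\<close>

subsection \<open>Weights and their partial sums\<close>

definition weight :: "real \<Rightarrow> nat \<Rightarrow> real" where
  "weight \<alpha> k = real (k + 1) powr \<alpha>"

definition kernel_sum :: "real \<Rightarrow> nat \<Rightarrow> real" where
  "kernel_sum \<alpha> N = (\<Sum>k\<le>N. 1 / weight \<alpha> k)"

lemma weight_pos [simp]: "weight \<alpha> k > 0"
  by (simp add: weight_def)

lemma weight_nonneg [simp]: "weight \<alpha> k \<ge> 0"
  by (simp add: weight_def)

lemma weight_neq_0 [simp]: "weight \<alpha> k \<noteq> 0"
  using weight_pos[of \<alpha> k] by linarith

lemma weight_0 [simp]: "weight \<alpha> 0 = 1"
  by (simp add: weight_def)

lemma inverse_weight: "1 / weight \<alpha> k = real (k + 1) powr (- \<alpha>)"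
  by (simp add: weight_def powr_minus_divide)

lemma weight_le_Suc:
  assumes "\<alpha> \<le> 1"
  shows "weight \<alpha> k \<le> real (k + 1)"
  using powr_mono[of \<alpha> 1 "real (k + 1)"] assms by (simp add: weight_def)

text \<open>For \<open>\<alpha> \<ge> 0\<close> the reason is
  \<open>i + j + 1 \<le> (i + 1) * (j + 1)\<close>, for \<open>\<alpha> < 0\<close> monotonicity. It
  makes a series with summable \<open>(k + 1) * |L_k|\<close> a bounded multiplier for every
  \<open>\<alpha> \<le> 1\<close>.\<close>

lemma weight_add_le_mult:
  assumes "\<alpha> \<le> 1"
  shows "weight \<alpha> (i + j) \<le> real (i + 1) * weight \<alpha> j"
proof (cases "\<alpha> \<ge> 0")
  case True
  have "weight \<alpha> (i + j) \<le> (real (i + 1) * real (j + 1)) powr \<alpha>"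
    unfolding weight_def using True by (intro powr_mono2) (auto simp: algebra_simps)
  also have "\<dots> = weight \<alpha> i * weight \<alpha> j"
    by (simp add: weight_def powr_mult)
  also have "\<dots> \<le> real (i + 1) * weight \<alpha> j"
    using weight_le_Suc[OF assms] by (intro mult_right_mono) auto
  finally show ?thesis .
next
  case False
  have "weight \<alpha> (i + j) \<le> 1 * weight \<alpha> j"
    using False by (auto simp: weight_def intro!: powr_mono2')
  also have "\<dots> \<le> real (i + 1) * weight \<alpha> j"
    by (intro mult_right_mono) auto
  finally show ?thesis .
qed

text \<open>For \<open>\<alpha> \<ge> 0\<close>, apply \<open>t \<le> t powr \<alpha>\<close> to two
  fractions with sum 1; for negative \<open>\<alpha>\<close> the weight decreases. Sharing the
  weight between two factors is what keeps \<open>flat\<close> closed under products.\<close>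

lemma weight_add_le_add:
  assumes "\<alpha> \<le> 1"
  shows "weight \<alpha> (i + j) \<le> weight \<alpha> i + weight \<alpha> j"
proof (cases "\<alpha> \<ge> 0")
  case True
  \<comment> \<open>One more than \<open>i + j + 1\<close>, so that \<open>(i + 1) / s\<close> and
    \<open>(j + 1) / s\<close> sum to 1.\<close>
  define s where "s = real (i + 1) + real (j + 1)"
  have s: "s > 0" by (simp add: s_def)
  have le: "t \<le> t powr \<alpha>" if "0 < t" "t \<le> 1" for t :: real
    using powr_mono'[of \<alpha> 1 t] that assms by simp
  have split: "x powr \<alpha> = s powr \<alpha> * (x / s) powr \<alpha>" if "x > 0" for x
    using s that by (simp add: powr_divide)
  have "weight \<alpha> (i + j) \<le> s powr \<alpha>"
    unfolding weight_def s_def using True by (intro powr_mono2) auto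
  also have "\<dots> = s powr \<alpha> * (real (i + 1) / s + real (j + 1) / s)"
    using s by (simp add: s_def add_divide_distrib[symmetric])
  also have "\<dots> \<le> s powr \<alpha> * ((real (i + 1) / s) powr \<alpha> + (real (j + 1) / s) powr \<alpha>)"
    using s by (intro mult_left_mono add_mono le) (auto simp: s_def)
  also have "\<dots> = weight \<alpha> i + weight \<alpha> j"
    using split[of "real (i + 1)"] split[of "real (j + 1)"]
    by (simp add: weight_def distrib_left)
  finally show ?thesis .
next
  case False
  have "weight \<alpha> (i + j) \<le> weight \<alpha> j"
    using False by (auto simp: weight_def intro!: powr_mono2')
  then show ?thesis using weight_nonneg[of \<alpha> i] by linarith
qed

lemma kernel_sum_ge_1: "kernel_sum \<alpha> N \<ge> 1"
proof -
  have "(\<Sum>k\<in>{0}. 1 / weight \<alpha> k) \<le> kernel_sum \<alpha> N"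
    unfolding kernel_sum_def by (intro sum_mono2) auto
  then show ?thesis by simp
qed

lemma kernel_sum_pos [simp]: "kernel_sum \<alpha> N > 0"
  using kernel_sum_ge_1[of \<alpha> N] by linarith

lemma kernel_sum_nonneg [simp]: "kernel_sum \<alpha> N \<ge> 0"
  using kernel_sum_ge_1[of \<alpha> N] by linarith

lemma kernel_sum_neq_0 [simp]: "kernel_sum \<alpha> N \<noteq> 0"
  using kernel_sum_pos[of \<alpha> N] by linarith

lemma kernel_sum_mono: "M \<le> N \<Longrightarrow> kernel_sum \<alpha> M \<le> kernel_sum \<alpha> N"
  unfolding kernel_sum_def by (intro sum_mono2) auto

text \<open>Crude polynomial growth, enough against the exponentially small Taylor tails in
  \<open>flat_truncation\<close>.\<close>

lemma kernel_sum_le_power: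
  assumes "\<bar>\<alpha>\<bar> \<le> real b"
  shows "kernel_sum \<alpha> N \<le> real (N + 1) ^ Suc b"
proof -
  have "1 / weight \<alpha> k \<le> real (N + 1) ^ b" if "k \<le> N" for k
  proof -
    have "1 / weight \<alpha> k \<le> real (k + 1) powr real b"
      unfolding inverse_weight using assms by (intro powr_mono) auto
    also have "\<dots> \<le> real (N + 1) powr real b"
      using that by (intro powr_mono2) auto
    finally show ?thesis by (simp add: powr_realpow del: of_nat_Suc)
  qed
  then have "kernel_sum \<alpha> N \<le> (\<Sum>k\<le>N. real (N + 1) ^ b)"
    unfolding kernel_sum_def by (intro sum_mono) auto
  then show ?thesis by simp
qed

text \<open>Cut the indices into blocks of length \<open>d\<close>: for \<open>k\<close> in block
  \<open>j\<close>, \<open>k + 1\<close> lies between \<open>j + 1\<close> and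
  \<open>d * (j + 1)\<close>, so \<open>1 / weight\<close> exceeds its value at \<open>j\<close> at
  most by the factor \<open>d powr \<bar>\<alpha>\<bar>\<close>. Both bounds use this to absorb
  linear changes of the degree into constants.\<close>

lemma kernel_sum_dilate:
  assumes "d > 0" "n < d * (N + 1)"
  shows "kernel_sum \<alpha> n \<le> real d * real d powr \<bar>\<alpha>\<bar> * kernel_sum \<alpha> N"
proof -
  have *: "1 / weight \<alpha> k \<le> real d powr \<bar>\<alpha>\<bar> * (1 / weight \<alpha> j)"
    if "k \<in> {j * d..<j * d + d}" for j k
  proof -
    have lo: "real (j + 1) \<le> real (k + 1)"
      using that assms(1) by (auto intro: order_trans[of j "j * d"])
    have "k + 1 \<le> d * (j + 1)"
      using that by (auto simp: algebra_simps)
    then have hi: "real (k + 1) \<le> real d * real (j + 1)"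
      by (metis of_nat_le_iff of_nat_mult)
    show ?thesis
    proof (cases "\<alpha> \<ge> 0")
      case True
      have "real (k + 1) powr (-\<alpha>) \<le> real (j + 1) powr (-\<alpha>)"
        using True lo by (intro powr_mono2') auto
      also have "\<dots> \<le> real d powr \<bar>\<alpha>\<bar> * real (j + 1) powr (-\<alpha>)"
        using ge_one_powr_ge_zero[of "real d" "\<bar>\<alpha>\<bar>"] assms(1)
          mult_right_mono[of 1 "real d powr \<bar>\<alpha>\<bar>" "real (j + 1) powr (-\<alpha>)"] by auto
      finally show ?thesis unfolding inverse_weight .
    next
      case False
      have "real (k + 1) powr (-\<alpha>) \<le> (real d * real (j + 1)) powr (-\<alpha>)"
        using False hi by (intro powr_mono2) auto
      also have "\<dots> = real d powr \<bar>\<alpha>\<bar> * real (j + 1) powr (-\<alpha>)"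
        using False by (simp add: powr_mult)
      finally show ?thesis unfolding inverse_weight .
    qed
  qed
  have "kernel_sum \<alpha> n \<le> (\<Sum>k<(N + 1) * d. 1 / weight \<alpha> k)"
    unfolding kernel_sum_def using assms(2) by (intro sum_mono2) (auto simp: algebra_simps)
  also have "\<dots> = (\<Sum>j<N + 1. \<Sum>k = j * d..<j * d + d. 1 / weight \<alpha> k)"
    by (simp only: sum.nat_group)
  also have "\<dots> \<le> (\<Sum>j<N + 1. \<Sum>k = j * d..<j * d + d. real d powr \<bar>\<alpha>\<bar> * (1 / weight \<alpha> j))"
    using * by (intro sum_mono) auto
  also have "\<dots> = real d * real d powr \<bar>\<alpha>\<bar> * kernel_sum \<alpha> N"
    by (simp add: kernel_sum_def sum_distrib_left lessThan_Suc_atMost mult_ac)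
  finally show ?thesis .
qed

section \<open>Comparison of the partial sums with \<open>phi\<close>\<close>

lemma powr_diff_MVT:
  fixes x \<beta> :: real
  assumes "x > 0"
  obtains \<xi> where "x < \<xi>" "\<xi> < x + 1" "(x + 1) powr \<beta> - x powr \<beta> = \<beta> * \<xi> powr (\<beta> - 1)"
proof -
  have "\<exists>z>x. z < x + 1 \<and> (x + 1) powr \<beta> - x powr \<beta> = (x + 1 - x) * (\<beta> * z powr (\<beta> - 1))"
    using assms by (intro MVT2) (auto intro!: derivative_eq_intros)
  then show ?thesis using that by auto
qed

text \<open>For \<open>\<alpha> \<le> 0\<close> every term is at most the last one; for
  \<open>0 < \<alpha> < 1\<close> the terms are compared with increments of
  \<open>s powr (1 - \<alpha>)\<close>, as in the integral test; for \<open>\<alpha> = 1\<close> the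
  sum is harmonic. Requiring \<open>N \<ge> 1\<close> keeps away from the zero of the logarithm at
  1.\<close>

lemma kernel_sum_le_phi:
  assumes "\<alpha> \<le> 1"
  obtains c where "c > 0" "\<And>N. N \<ge> 1 \<Longrightarrow> kernel_sum \<alpha> N \<le> c * phi \<alpha> (real (N + 1))"
proof -
  consider "\<alpha> = 1" | "\<alpha> \<le> 0" | "0 < \<alpha>" "\<alpha> < 1" using assms by linarith
  then show ?thesis
  proof cases
    case 1
    show ?thesis
    \<comment> \<open>The summand \<open>1 / ln 2\<close> pays for the additive 1 in
      \<open>ln (N + 1) + 1\<close>, because \<open>ln (N + 1) \<ge> ln 2\<close>.\<close>
    proof (rule that[of "1 / ln 2 + 1"])
      fix N :: nat assume N: "N \<ge> 1"
      have "kernel_sum \<alpha> N = harm (Suc N)"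
        by (simp add: 1 kernel_sum_def weight_def harm_altdef lessThan_Suc_atMost
              divide_inverse add.commute)
      also have "\<dots> \<le> ln (real (Suc N)) + 1"
        using decseq_harm_diff_ln unfolding decseq_def
        by (drule_tac x=0 in spec, drule_tac x=N in spec) (auto simp: harm_Suc harm_def)
      also have "1 \<le> ln (real (Suc N)) / ln 2"
        using N by simp
      finally show "kernel_sum \<alpha> N \<le> (1 / ln 2 + 1) * phi \<alpha> (real (N + 1))"
        using 1 ln_ge_zero[of "real (N + 1)"] by (simp add: phi_def algebra_simps)
    qed (simp add: add_pos_pos)
  next
    case 2
    show ?thesis
    proof (rule that[of 1])
      fix N :: nat
      have "kernel_sum \<alpha> N \<le> (\<Sum>k\<le>N. real (N + 1) powr (-\<alpha>))"
        unfolding kernel_sum_def inverse_weight using 2 by (intro sum_mono powr_mono2) auto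
      also have "\<dots> = real (N + 1) powr (1 - \<alpha>)"
        by (simp add: powr_diff powr_minus_divide)
      finally show "kernel_sum \<alpha> N \<le> 1 * phi \<alpha> (real (N + 1))"
        using 2 by (simp add: phi_def)
    qed simp
  next
    case 3
    show ?thesis
    proof (rule that[of "1 / (1 - \<alpha>)"])
      fix N :: nat
      have "(1 - \<alpha>) * kernel_sum \<alpha> N \<le> real (N + 1) powr (1 - \<alpha>)"
      proof (induction N)
        case 0
        then show ?case using 3 by (simp add: kernel_sum_def)
      next
        case (Suc N)
        obtain \<xi> where \<xi>: "real (N + 1) < \<xi>" "\<xi> < real (N + 1) + 1"
          "(real (N + 1) + 1) powr (1 - \<alpha>) - real (N + 1) powr (1 - \<alpha>) = (1 - \<alpha>) * \<xi> powr (1 - \<alpha> - 1)"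
          using powr_diff_MVT[of "real (N + 1)" "1 - \<alpha>"] by auto
        have "real (Suc N + 1) powr (-\<alpha>) \<le> \<xi> powr (-\<alpha>)"
          using 3 \<xi> by (intro powr_mono2') auto
        then have "(1 - \<alpha>) * real (Suc N + 1) powr (-\<alpha>) \<le> (1 - \<alpha>) * \<xi> powr (-\<alpha>)"
          using 3 by (intro mult_left_mono) auto
        then show ?case
          using Suc \<xi>(3) by (simp add: kernel_sum_def inverse_weight distrib_left add_ac)
      qed
      then show "kernel_sum \<alpha> N \<le> 1 / (1 - \<alpha>) * phi \<alpha> (real (N + 1))"
        using 3 by (simp add: phi_def field_simps)
    qed (use 3 in simp)
  qed
qed

text \<open>The same comparisons with monotonicity reversed: the mean value theorem now serves
  negative \<open>\<alpha>\<close>, and comparison with the last term serves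
  \<open>0 \<le> \<alpha> < 1\<close>.\<close>

lemma phi_le_kernel_sum:
  assumes "\<alpha> \<le> 1"
  obtains c where "c > 0" "\<And>N. phi \<alpha> (real (N + 1)) \<le> c * kernel_sum \<alpha> N"
proof -
  consider "\<alpha> = 1" | "\<alpha> < 0" | "0 \<le> \<alpha>" "\<alpha> < 1" using assms by linarith
  then show ?thesis
  proof cases
    case 1
    show ?thesis
    proof (rule that[of 1])
      fix N :: nat
      have "kernel_sum \<alpha> N = harm (Suc N)"
        by (simp add: 1 kernel_sum_def weight_def harm_altdef lessThan_Suc_atMost
              divide_inverse add.commute)
      moreover have "ln (real (N + 1)) \<le> ln (real (Suc N) + 1)"
        by simp
      moreover have "phi \<alpha> (real (N + 1)) = ln (real (N + 1))"
        using 1 ln_ge_zero[of "real (N + 1)"] by (simp add: phi_def)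
      ultimately show "phi \<alpha> (real (N + 1)) \<le> 1 * kernel_sum \<alpha> N"
        using ln_le_harm[of "Suc N"] by linarith
    qed simp
  next
    case 2
    show ?thesis
    proof (rule that[of "1 - \<alpha>"])
      fix N :: nat
      have "real (N + 1) powr (1 - \<alpha>) \<le> (1 - \<alpha>) * kernel_sum \<alpha> N"
      proof (induction N)
        case 0
        then show ?case using 2 by (simp add: kernel_sum_def)
      next
        case (Suc N)
        obtain \<xi> where \<xi>: "real (N + 1) < \<xi>" "\<xi> < real (N + 1) + 1"
          "(real (N + 1) + 1) powr (1 - \<alpha>) - real (N + 1) powr (1 - \<alpha>) = (1 - \<alpha>) * \<xi> powr (1 - \<alpha> - 1)"
          using powr_diff_MVT[of "real (N + 1)" "1 - \<alpha>"] by auto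
        have "\<xi> powr (-\<alpha>) \<le> real (Suc N + 1) powr (-\<alpha>)"
          using 2 \<xi> by (intro powr_mono2) auto
        then have "(1 - \<alpha>) * \<xi> powr (-\<alpha>) \<le> (1 - \<alpha>) * real (Suc N + 1) powr (-\<alpha>)"
          using 2 by (intro mult_left_mono) auto
        then show ?case
          using Suc \<xi>(3) by (simp add: kernel_sum_def inverse_weight distrib_left add_ac)
      qed
      then show "phi \<alpha> (real (N + 1)) \<le> (1 - \<alpha>) * kernel_sum \<alpha> N"
        using 2 by (simp add: phi_def)
    qed (use 2 in simp)
  next
    case 3
    show ?thesis
    proof (rule that[of 1])
      fix N :: nat
      have "real (N + 1) powr (1 - \<alpha>) = (\<Sum>k\<le>N. real (N + 1) powr (-\<alpha>))"
        by (simp add: powr_diff powr_minus_divide)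
      also have "\<dots> \<le> kernel_sum \<alpha> N"
        unfolding kernel_sum_def inverse_weight using 3 by (intro sum_mono powr_mono2') auto
      finally show "phi \<alpha> (real (N + 1)) \<le> 1 * kernel_sum \<alpha> N"
        using 3 by (simp add: phi_def)
    qed simp
  qed
qed

subsection \<open>Coefficient estimates for power series\<close>

text \<open>\<open>A\<close> controls the coefficient sum and \<open>B\<close> a weighted supremum;
  interpolation between them controls the squared norm (\<open>dnorm_bound_flat\<close>). In the
  applications to error terms \<open>A\<close> stays bounded while \<open>B\<close> is of order
  \<open>1 / kernel_sum \<alpha> N\<close>.\<close>

definition flat :: "real \<Rightarrow> complex fps \<Rightarrow> real \<Rightarrow> real \<Rightarrow> bool" where
  "flat \<alpha> F A B \<longleftrightarrow>
     (\<forall>K. (\<Sum>k<K. cmod (fps_nth F k)) \<le> A) \<and> (\<forall>k. weight \<alpha> k * cmod (fps_nth F k) \<le> B)"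

text \<open>A bound for the squared norm, phrased with partial sums to avoid summability side conditions.\<close>

definition dnorm_bound :: "real \<Rightarrow> complex fps \<Rightarrow> real \<Rightarrow> bool" where
  "dnorm_bound \<alpha> F B \<longleftrightarrow> (\<forall>K. (\<Sum>k<K. weight \<alpha> k * (cmod (fps_nth F k))\<^sup>2) \<le> B)"

text \<open>The coefficient form of being holomorphic on a disk of radius greater than 1.\<close>

definition rapid_decay :: "complex fps \<Rightarrow> bool" where
  "rapid_decay F \<longleftrightarrow>
     (\<exists>C \<rho>. C \<ge> 0 \<and> 0 < \<rho> \<and> \<rho> < 1 \<and> (\<forall>k. cmod (fps_nth F k) \<le> C * \<rho> ^ k))"

lemma flatD:
  assumes "flat \<alpha> F A B"
  shows "(\<Sum>k<K. cmod (fps_nth F k)) \<le> A" "weight \<alpha> k * cmod (fps_nth F k) \<le> B"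
    "0 \<le> A" "0 \<le> B"
proof -
  show "(\<Sum>k<K. cmod (fps_nth F k)) \<le> A" "weight \<alpha> k * cmod (fps_nth F k) \<le> B"
    using assms unfolding flat_def by auto
  have "(\<Sum>k<0. cmod (fps_nth F k)) \<le> A" "weight \<alpha> 0 * cmod (fps_nth F 0) \<le> B"
    using assms unfolding flat_def by blast+
  then show "0 \<le> A" "0 \<le> B" using order_trans[OF norm_ge_zero] by simp_all
qed

text \<open>The triangle \<open>i + j < K\<close> lies inside the square of side
  \<open>K\<close>.\<close>

lemma sum_convolution_le:
  fixes h :: "nat \<Rightarrow> nat \<Rightarrow> real"
  assumes "\<And>i j. h i j \<ge> 0"
  shows "(\<Sum>k<K. \<Sum>i\<le>k. h i (k - i)) \<le> (\<Sum>i<K. \<Sum>j<K. h i j)"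
proof -
  have "(\<Sum>k<K. \<Sum>i\<le>k. h i (k - i)) = (\<Sum>(i, j)\<in>{(i, j). i + j < K}. h i j)"
    by (simp add: sum.triangle_reindex)
  also have "\<dots> \<le> (\<Sum>(i, j)\<in>{..<K} \<times> {..<K}. h i j)"
    using assms by (intro sum_mono2) auto
  also have "\<dots> = (\<Sum>i<K. \<Sum>j<K. h i j)"
    by (simp add: sum.cartesian_product)
  finally show ?thesis .
qed

lemma norm_fps_mult_nth_le:
  fixes F G :: "complex fps"
  shows "cmod (fps_nth (F * G) k) \<le> (\<Sum>i\<le>k. cmod (fps_nth F i) * cmod (fps_nth G (k - i)))"
  unfolding fps_mult_nth atMost_atLeast0[symmetric]
  by (intro order_trans[OF norm_sum] sum_mono) (simp add: norm_mult)

lemma sum_norm_mult_le: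
  assumes F: "\<And>K. (\<Sum>k<K. cmod (fps_nth F k)) \<le> A"
    and G: "\<And>K. (\<Sum>k<K. cmod (fps_nth G k)) \<le> A'"
  shows "(\<Sum>k<K. cmod (fps_nth (F * G) k)) \<le> A * A'"
proof -
  have "(\<Sum>k<K. cmod (fps_nth (F * G) k))
      \<le> (\<Sum>k<K. \<Sum>i\<le>k. cmod (fps_nth F i) * cmod (fps_nth G (k - i)))"
    by (intro sum_mono norm_fps_mult_nth_le)
  also have "\<dots> \<le> (\<Sum>i<K. \<Sum>j<K. cmod (fps_nth F i) * cmod (fps_nth G j))"
    by (rule sum_convolution_le) auto
  also have "\<dots> = (\<Sum>i<K. cmod (fps_nth F i)) * (\<Sum>j<K. cmod (fps_nth G j))"
    by (simp add: sum_product)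
  also have "\<dots> \<le> A * A'"
    using F[of 0] by (intro mult_mono F G sum_nonneg) auto
  finally show ?thesis .
qed

text \<open>In each term of the convolution \<open>weight_add_le_add\<close> splits the weight; the
  factor receiving a share is bounded by its supremum bound, and the other one contributes its
  coefficient sum.\<close>

lemma flat_mult:
  assumes "\<alpha> \<le> 1" and F: "flat \<alpha> F A B" and G: "flat \<alpha> G A' B'"
  shows "flat \<alpha> (F * G) (A * A') (A' * B + A * B')"
  unfolding flat_def
proof (intro conjI allI)
  fix K show "(\<Sum>k<K. cmod (fps_nth (F * G) k)) \<le> A * A'"
    using flatD(1)[OF F] flatD(1)[OF G] by (rule sum_norm_mult_le)
next
  fix k
  let ?f = "\<lambda>i. cmod (fps_nth F i)" and ?g = "\<lambda>i. cmod (fps_nth G i)"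
  have "weight \<alpha> k * cmod (fps_nth (F * G) k) \<le> (\<Sum>i\<le>k. weight \<alpha> k * (?f i * ?g (k - i)))"
    unfolding sum_distrib_left[symmetric] by (intro mult_left_mono norm_fps_mult_nth_le) auto
  also have "\<dots> \<le> (\<Sum>i\<le>k. ?g (k - i) * B + ?f i * B')"
  proof (intro sum_mono)
    fix i assume "i \<in> {..k}"
    then have "weight \<alpha> k \<le> weight \<alpha> i + weight \<alpha> (k - i)"
      using weight_add_le_add[OF assms(1), of i "k - i"] by simp
    then have "weight \<alpha> k * (?f i * ?g (k - i)) \<le> (weight \<alpha> i + weight \<alpha> (k - i)) * (?f i * ?g (k - i))"
      by (intro mult_right_mono) auto
    also have "\<dots> = ?g (k - i) * (weight \<alpha> i * ?f i) + ?f i * (weight \<alpha> (k - i) * ?g (k - i))"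
      by (simp add: algebra_simps)
    also have "\<dots> \<le> ?g (k - i) * B + ?f i * B'"
      by (intro add_mono mult_left_mono flatD(2)[OF F] flatD(2)[OF G]) auto
    finally show "weight \<alpha> k * (?f i * ?g (k - i)) \<le> ?g (k - i) * B + ?f i * B'" .
  qed
  also have "\<dots> = (\<Sum>i\<le>k. ?g (k - i)) * B + (\<Sum>i\<le>k. ?f i) * B'"
    by (simp add: sum.distrib sum_distrib_right)
  also have "(\<Sum>i\<le>k. ?g (k - i)) = (\<Sum>i<Suc k. ?g i)"
    using sum.nat_diff_reindex[of ?g "Suc k"] by (simp add: lessThan_Suc_atMost)
  also have "(\<Sum>i\<le>k. ?f i) = (\<Sum>i<Suc k. ?f i)"
    by (simp add: lessThan_Suc_atMost)
  also have "(\<Sum>i<Suc k. ?g i) * B + (\<Sum>i<Suc k. ?f i) * B' \<le> A' * B + A * B'"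
    by (intro add_mono mult_right_mono flatD[OF F] flatD[OF G])
  finally show "weight \<alpha> k * cmod (fps_nth (F * G) k) \<le> A' * B + A * B'" .
qed

lemma flat_add:
  assumes F: "flat \<alpha> F A B" and G: "flat \<alpha> G A' B'"
  shows "flat \<alpha> (F + G) (A + A') (B + B')"
  unfolding flat_def
proof (intro conjI allI)
  fix K
  have "(\<Sum>k<K. cmod (fps_nth (F + G) k)) \<le> (\<Sum>k<K. cmod (fps_nth F k) + cmod (fps_nth G k))"
    by (intro sum_mono) (auto intro: norm_triangle_ineq)
  then show "(\<Sum>k<K. cmod (fps_nth (F + G) k)) \<le> A + A'"
    using flatD(1)[OF F, of K] flatD(1)[OF G, of K] by (simp add: sum.distrib)
next
  fix k
  have "weight \<alpha> k * cmod (fps_nth (F + G) k)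
      \<le> weight \<alpha> k * (cmod (fps_nth F k) + cmod (fps_nth G k))"
    by (intro mult_left_mono) (auto intro: norm_triangle_ineq)
  then show "weight \<alpha> k * cmod (fps_nth (F + G) k) \<le> B + B'"
    using flatD(2)[OF F, of k] flatD(2)[OF G, of k] by (simp add: distrib_left)
qed

lemma sum_norm_le_weighted:
  assumes "\<And>K. (\<Sum>k<K. real (k + 1) * cmod (fps_nth L k)) \<le> M"
  shows "(\<Sum>k<K. cmod (fps_nth L k)) \<le> M"
proof -
  have "(\<Sum>k<K. 1 * cmod (fps_nth L k)) \<le> (\<Sum>k<K. real (k + 1) * cmod (fps_nth L k))"
    by (intro sum_mono mult_right_mono) auto
  with assms[of K] show ?thesis by simp
qed

text \<open>For a fixed series \<open>L\<close>, \<open>flat_mult\<close> would lose the smallness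
  of \<open>B\<close>. With \<open>weight_add_le_mult\<close> the whole weight goes to
  \<open>F\<close> at the cost of a factor \<open>i + 1\<close> on \<open>L\<close>, so both bounds
  merely scale by \<open>M\<close>.\<close>

lemma flat_multiplier:
  assumes "\<alpha> \<le> 1" and L: "\<And>K. (\<Sum>k<K. real (k + 1) * cmod (fps_nth L k)) \<le> M"
    and F: "flat \<alpha> F A B"
  shows "flat \<alpha> (L * F) (M * A) (M * B)"
  unfolding flat_def
proof (intro conjI allI)
  fix K
  show "(\<Sum>k<K. cmod (fps_nth (L * F) k)) \<le> M * A"
    using sum_norm_le_weighted[OF L] flatD(1)[OF F] by (rule sum_norm_mult_le)
next
  fix k
  let ?l = "\<lambda>i. cmod (fps_nth L i)" and ?f = "\<lambda>i. cmod (fps_nth F i)"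
  have "weight \<alpha> k * cmod (fps_nth (L * F) k) \<le> (\<Sum>i\<le>k. weight \<alpha> k * (?l i * ?f (k - i)))"
    unfolding sum_distrib_left[symmetric] by (intro mult_left_mono norm_fps_mult_nth_le) auto
  also have "\<dots> \<le> (\<Sum>i\<le>k. real (i + 1) * ?l i * B)"
  proof (intro sum_mono)
    fix i assume "i \<in> {..k}"
    then have "weight \<alpha> k \<le> real (i + 1) * weight \<alpha> (k - i)"
      using weight_add_le_mult[OF assms(1), of i "k - i"] by simp
    then have "weight \<alpha> k * (?l i * ?f (k - i)) \<le> (real (i + 1) * weight \<alpha> (k - i)) * (?l i * ?f (k - i))"
      by (intro mult_right_mono) auto
    also have "\<dots> = real (i + 1) * ?l i * (weight \<alpha> (k - i) * ?f (k - i))"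
      by (simp add: mult_ac)
    also have "\<dots> \<le> real (i + 1) * ?l i * B"
      by (intro mult_left_mono flatD(2)[OF F]) auto
    finally show "weight \<alpha> k * (?l i * ?f (k - i)) \<le> real (i + 1) * ?l i * B" .
  qed
  also have "\<dots> = (\<Sum>i<Suc k. real (i + 1) * ?l i) * B"
    by (simp only: sum_distrib_right lessThan_Suc_atMost)
  also have "\<dots> \<le> M * B"
    by (intro mult_right_mono L flatD(4)[OF F])
  finally show "weight \<alpha> k * cmod (fps_nth (L * F) k) \<le> M * B" .
qed

text \<open>Read \<open>weight k * |F_k|^2\<close> as \<open>|F_k|\<close> times
  \<open>weight k * |F_k|\<close>: the first factor is summed, the second bounded by its
  supremum.\<close>

lemma dnorm_bound_flat:
  assumes F: "flat \<alpha> F A B"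
  shows "dnorm_bound \<alpha> F (A * B)"
  unfolding dnorm_bound_def
proof
  fix K
  have "(\<Sum>k<K. weight \<alpha> k * (cmod (fps_nth F k))\<^sup>2) \<le> (\<Sum>k<K. cmod (fps_nth F k) * B)"
  proof (intro sum_mono)
    fix k :: nat
    have "cmod (fps_nth F k) * (weight \<alpha> k * cmod (fps_nth F k)) \<le> cmod (fps_nth F k) * B"
      by (intro mult_left_mono flatD(2)[OF F]) auto
    then show "weight \<alpha> k * (cmod (fps_nth F k))\<^sup>2 \<le> cmod (fps_nth F k) * B"
      by (simp add: power2_eq_square mult_ac)
  qed
  also have "\<dots> = (\<Sum>k<K. cmod (fps_nth F k)) * B" by (simp add: sum_distrib_right)
  also have "\<dots> \<le> A * B" using flatD[OF F] by (intro mult_right_mono) auto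
  finally show "(\<Sum>k<K. weight \<alpha> k * (cmod (fps_nth F k))\<^sup>2) \<le> A * B" .
qed

text \<open>A Young-type inequality: Cauchy-Schwarz against the masses \<open>|L_i|\<close>, then
  \<open>weight_add_le_mult\<close> inside the convolution. The lower bound uses it with
  \<open>L\<close> the expansion of \<open>1 / u\<close>.\<close>

lemma dnorm_bound_multiplier:
  assumes "\<alpha> \<le> 1" and L: "\<And>K. (\<Sum>k<K. real (k + 1) * cmod (fps_nth L k)) \<le> M"
    and F: "dnorm_bound \<alpha> F B"
  shows "dnorm_bound \<alpha> (L * F) (M\<^sup>2 * B)"
  unfolding dnorm_bound_def
proof
  fix K
  let ?l = "\<lambda>i. cmod (fps_nth L i)" and ?f = "\<lambda>i. cmod (fps_nth F i)"
  have M: "M \<ge> 0" using L[of 0] by simp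
  note l1 = sum_norm_le_weighted[OF L]
  have pt: "(cmod (fps_nth (L * F) k))\<^sup>2 \<le> M * (\<Sum>i\<le>k. ?l i * (?f (k - i))\<^sup>2)" for k
  proof -
    have "(cmod (fps_nth (L * F) k))\<^sup>2 \<le> (\<Sum>i\<le>k. ?l i * ?f (k - i))\<^sup>2"
      by (intro power_mono norm_fps_mult_nth_le) auto
    \<comment> \<open>Placing \<open>sqrt |L_i|\<close> in each factor leaves only first powers of
      \<open>|L_i|\<close>, whose sums are bounded by \<open>M\<close>.\<close>
    also have "\<dots> = (\<Sum>i\<le>k. sqrt (?l i) * (sqrt (?l i) * ?f (k - i)))\<^sup>2"
      by (simp add: mult.assoc[symmetric])
    also have "\<dots> \<le> (\<Sum>i\<le>k. (sqrt (?l i))\<^sup>2) * (\<Sum>i\<le>k. (sqrt (?l i) * ?f (k - i))\<^sup>2)"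
      by (rule Cauchy_Schwarz_ineq_sum)
    also have "\<dots> = (\<Sum>i<Suc k. ?l i) * (\<Sum>i\<le>k. ?l i * (?f (k - i))\<^sup>2)"
      by (simp only: power_mult_distrib real_sqrt_pow2 norm_ge_zero lessThan_Suc_atMost)
    also have "\<dots> \<le> M * (\<Sum>i\<le>k. ?l i * (?f (k - i))\<^sup>2)"
      by (intro mult_right_mono l1 sum_nonneg) auto
    finally show ?thesis .
  qed
  have "(\<Sum>k<K. weight \<alpha> k * (cmod (fps_nth (L * F) k))\<^sup>2)
      \<le> (\<Sum>k<K. weight \<alpha> k * (M * (\<Sum>i\<le>k. ?l i * (?f (k - i))\<^sup>2)))"
    by (intro sum_mono mult_left_mono pt) auto
  also have "\<dots> = M * (\<Sum>k<K. \<Sum>i\<le>k. weight \<alpha> k * (?l i * (?f (k - i))\<^sup>2))"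
    by (simp add: sum_distrib_left mult_ac)
  also have "\<dots> \<le> M * (\<Sum>k<K. \<Sum>i\<le>k. real (i + 1) * ?l i * (weight \<alpha> (k - i) * (?f (k - i))\<^sup>2))"
  proof (intro mult_left_mono sum_mono)
    fix k i :: nat assume "i \<in> {..k}"
    then have "weight \<alpha> k \<le> real (i + 1) * weight \<alpha> (k - i)"
      using weight_add_le_mult[OF assms(1), of i "k - i"] by simp
    then have "weight \<alpha> k * (?l i * (?f (k - i))\<^sup>2)
        \<le> (real (i + 1) * weight \<alpha> (k - i)) * (?l i * (?f (k - i))\<^sup>2)"
      by (intro mult_right_mono) auto
    then show "weight \<alpha> k * (?l i * (?f (k - i))\<^sup>2)
        \<le> real (i + 1) * ?l i * (weight \<alpha> (k - i) * (?f (k - i))\<^sup>2)"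
      by (simp add: mult_ac)
  qed (use M in auto)
  also have "\<dots> \<le> M * (\<Sum>i<K. \<Sum>j<K. real (i + 1) * ?l i * (weight \<alpha> j * (?f j)\<^sup>2))"
    using M by (intro mult_left_mono sum_convolution_le[where h = "\<lambda>i j. real (i + 1) * ?l i * (weight \<alpha> j * (?f j)\<^sup>2)"]) auto
  also have "\<dots> = M * ((\<Sum>i<K. real (i + 1) * ?l i) * (\<Sum>j<K. weight \<alpha> j * (?f j)\<^sup>2))"
    by (simp only: sum_product)
  also have "\<dots> \<le> M * (M * B)"
    using M L F unfolding dnorm_bound_def by (intro mult_left_mono mult_mono sum_nonneg) auto
  finally show "(\<Sum>k<K. weight \<alpha> k * (cmod (fps_nth (L * F) k))\<^sup>2) \<le> M\<^sup>2 * B"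
    by (simp add: power2_eq_square mult_ac)
qed

section \<open>Sums of exponentially decaying coefficients\<close>

lemma bounded_sums_power_geometric:
  fixes \<rho> :: real
  assumes "0 < \<rho>" "\<rho> < 1"
  obtains M where "\<And>K. (\<Sum>k<K. real (k + 1) ^ b * \<rho> ^ k) \<le> M"
proof -
  \<comment> \<open>Half of the decay, \<open>r ^ k\<close>, absorbs the polynomial factor; the
    other half is summed as a geometric series.\<close>
  define r where "r = sqrt \<rho>"
  have r: "0 < r" "r < 1" "\<rho> = r * r"
    using assms by (auto simp: r_def)
  have "(\<lambda>k. real (k + 1) ^ b * r ^ k) \<longlonglongrightarrow> 0"
    using r by real_asymp
  then obtain C where C: "\<And>k. norm (real (k + 1) ^ b * r ^ k) \<le> C"
    using convergent_imp_Bseq[THEN BseqD] convergentI by blast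
  have "C \<ge> 0" using C[of 0] by simp
  have "(\<Sum>k<K. real (k + 1) ^ b * \<rho> ^ k) \<le> C * (1 / (1 - r))" for K
  proof -
    have "(\<Sum>k<K. real (k + 1) ^ b * \<rho> ^ k) \<le> (\<Sum>k<K. C * r ^ k)"
    proof (intro sum_mono)
      fix k
      have "real (k + 1) ^ b * \<rho> ^ k = (real (k + 1) ^ b * r ^ k) * r ^ k"
        by (simp add: r power_mult_distrib)
      also have "\<dots> \<le> C * r ^ k"
        using C[of k] r by (intro mult_right_mono) auto
      finally show "real (k + 1) ^ b * \<rho> ^ k \<le> C * r ^ k" .
    qed
    also have "\<dots> = C * (\<Sum>k<K. r ^ k)" by (simp add: sum_distrib_left)
    also have "(\<Sum>k<K. r ^ k) \<le> (\<Sum>k. r ^ k)"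
      using r by (intro sum_le_suminf) auto
    also have "(\<Sum>k. r ^ k) = 1 / (1 - r)"
      using r by (intro suminf_geometric) auto
    finally show ?thesis using \<open>C \<ge> 0\<close> by (simp add: mult_left_mono)
  qed
  then show ?thesis by (rule that)
qed

lemma rapid_decay_weighted_sums:
  assumes "rapid_decay F"
  obtains M where "\<And>K. (\<Sum>k<K. real (k + 1) ^ b * cmod (fps_nth F k)) \<le> M"
proof -
  from assms obtain C \<rho> where C: "C \<ge> 0" "0 < \<rho>" "\<rho> < 1"
    "\<And>k. cmod (fps_nth F k) \<le> C * \<rho> ^ k"
    unfolding rapid_decay_def by blast
  obtain M where M: "\<And>K. (\<Sum>k<K. real (k + 1) ^ b * \<rho> ^ k) \<le> M"
    using bounded_sums_power_geometric C by blast
  have "(\<Sum>k<K. real (k + 1) ^ b * cmod (fps_nth F k)) \<le> C * M" for K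
  proof -
    have "(\<Sum>k<K. real (k + 1) ^ b * cmod (fps_nth F k)) \<le> (\<Sum>k<K. real (k + 1) ^ b * (C * \<rho> ^ k))"
      by (intro sum_mono mult_left_mono C) auto
    also have "\<dots> = C * (\<Sum>k<K. real (k + 1) ^ b * \<rho> ^ k)"
      by (simp add: sum_distrib_left mult_ac)
    also have "\<dots> \<le> C * M" using C M by (intro mult_left_mono) auto
    finally show ?thesis .
  qed
  then show ?thesis by (rule that)
qed

subsection \<open>Factoring out the zeros on the circle\<close>

text \<open>A list records multiplicities and allows induction on one zero at a time.\<close>

definition zeros_poly :: "complex list \<Rightarrow> complex poly" where
  "zeros_poly zs = (\<Prod>z\<leftarrow>zs. [:-z, 1:])"

text \<open>Compactness gives one radius \<open>e\<close> that works around all points of the closed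
  disk; a point outside the disk is compared with its radial projection \<open>sgn z\<close>, at
  distance \<open>|z| - 1\<close>.\<close>

lemma cball_nbhd_obtains_ball:
  fixes U :: "complex set"
  assumes "open U" "cball 0 1 \<subseteq> U"
  obtains R where "R > 1" "ball 0 R \<subseteq> U"
proof -
  obtain e where e: "e > 0" "(\<Union>x\<in>cball 0 1. ball x e) \<subseteq> U"
    using compact_subset_open_imp_ball_epsilon_subset[OF compact_cball assms] by blast
  show ?thesis
  proof (rule that[of "1 + e"])
    show "1 + e > 1" using e by simp
    show "ball 0 (1 + e) \<subseteq> U"
    proof
      fix z :: complex assume z: "z \<in> ball 0 (1 + e)"
      show "z \<in> U"
      proof (cases "cmod z \<le> 1")
        case True
        then show ?thesis using assms by auto
      next
        case False
        have nz: "z \<noteq> 0" using False by (metis norm_zero zero_le_one)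
        have "z - sgn z = of_real (1 - 1 / cmod z) * z"
          using nz
          by (simp add: sgn_div_norm scaleR_conv_of_real algebra_simps divide_inverse)
        then have "cmod (z - sgn z) = \<bar>1 - 1 / cmod z\<bar> * cmod z"
          by (metis norm_mult norm_of_real)
        also have "\<dots> = cmod z - 1"
          using False nz by (simp add: abs_if field_simps)
        finally have "z \<in> ball (sgn z) e"
          using z by (simp add: dist_norm norm_minus_commute)
        moreover have "sgn z \<in> cball 0 1" by (simp add: norm_sgn)
        ultimately show ?thesis using e by blast
      qed
    qed
  qed
qed

text \<open>\<open>zor_poly\<close> is controlled only near \<open>z\<close>, and the quotient
  \<open>G w / (w - z) ^ m\<close> is holomorphic only away from \<open>z\<close>. They agree where
  both apply, so gluing them gives one function \<open>u\<close> on all of \<open>S\<close>.\<close>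

lemma holomorphic_divide_out_zero:
  assumes hol: "G holomorphic_on S" and S: "open S" "connected S" "z \<in> S"
    and nc: "\<exists>w\<in>S. G w \<noteq> 0"
  obtains u m where "u holomorphic_on S" "u z \<noteq> 0" "\<And>w. w \<in> S \<Longrightarrow> G w = (w - z) ^ m * u w"
proof -
  define m where "m = nat (zorder G z)"
  obtain r where r: "r > 0" "cball z r \<subseteq> S" "zor_poly G z holomorphic_on cball z r"
    "\<And>w. w \<in> cball z r \<Longrightarrow> G w = zor_poly G z w * (w - z) ^ m \<and> zor_poly G z w \<noteq> 0"
    using zorder_exist_zero[OF hol S nc] unfolding m_def by blast
  define u where "u w = (if w = z then zor_poly G z w else G w / (w - z) ^ m)" for w
  have "u holomorphic_on ball z r \<union> (S - {z})"
  proof (rule holomorphic_on_Un)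
    have "zor_poly G z holomorphic_on ball z r"
      using r(3) by (rule holomorphic_on_subset) auto
    then show "u holomorphic_on ball z r"
      by (rule holomorphic_transform) (use r(4) in \<open>auto simp: u_def\<close>)
    have "(\<lambda>w. G w / (w - z) ^ m) holomorphic_on S - {z}"
      by (intro holomorphic_intros holomorphic_on_subset[OF hol]) auto
    then show "u holomorphic_on S - {z}"
      by (rule holomorphic_transform) (auto simp: u_def)
  qed (use S in auto)
  moreover have "S \<subseteq> ball z r \<union> (S - {z})" using r(1) by auto
  ultimately have "u holomorphic_on S" by (rule holomorphic_on_subset)
  moreover have "u z \<noteq> 0" using r by (simp add: u_def)
  moreover have "G w = (w - z) ^ m * u w" if "w \<in> S" for w
    using r(1) r(4)[of z] by (auto simp: u_def)
  ultimately show ?thesis by (rule that)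
qed

lemma zeros_poly_simps [simp]:
  "zeros_poly [] = 1" "zeros_poly (z # zs) = [:-z, 1:] * zeros_poly zs"
  by (simp_all add: zeros_poly_def)

lemma zeros_poly_replicate_append:
  "poly (zeros_poly (replicate m z @ zs)) w = (w - z) ^ m * poly (zeros_poly zs) w"
  by (induction m) (simp_all add: algebra_simps)

text \<open>Induction on the number of distinct zeros in \<open>K\<close>: each step divides out one
  zero to its full order.\<close>

lemma holomorphic_zeros_factorization:
  assumes "G holomorphic_on S" "open S" "connected S" "compact K" "K \<subseteq> S" "K \<noteq> {}"
    and "\<exists>w\<in>S. G w \<noteq> 0"
  obtains zs u where "set zs \<subseteq> K" "u holomorphic_on S" "\<And>w. w \<in> K \<Longrightarrow> u w \<noteq> 0"
    "\<And>w. w \<in> S \<Longrightarrow> G w = poly (zeros_poly zs) w * u w"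
proof -
  have "\<exists>zs u. set zs \<subseteq> K \<and> u holomorphic_on S \<and> (\<forall>w\<in>K. u w \<noteq> 0) \<and>
      (\<forall>w\<in>S. G w = poly (zeros_poly zs) w * u w)"
    using assms(1,7)
  proof (induction "card {w\<in>K. G w = 0}" arbitrary: G rule: less_induct)
    case less
    have fin: "finite {w\<in>K. G w = 0}"
    \<comment> \<open>Finiteness of the zeros in a compact set is a fact about nonconstant
      functions; a constant \<open>G\<close> is nonzero here and has no zeros at all.\<close>
    proof (cases "G constant_on S")
      case True
      then have "{w\<in>K. G w = 0} = {}"
        using less.prems(2) assms(5) unfolding constant_on_def by force
      then show ?thesis by (metis finite.emptyI)
    next
      case False
      then show ?thesis
        using holomorphic_compact_finite_zeros[OF less.prems(1) assms(2-5)] by blast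
    qed
    show ?case
    proof (cases "\<exists>z\<in>K. G z = 0")
      case False
      then show ?thesis
        using less.prems by (intro exI[of _ "[]"] exI[of _ G]) auto
    next
      case True
      then obtain z where z: "z \<in> K" "G z = 0" by blast
      obtain u m where u: "u holomorphic_on S" "u z \<noteq> 0"
        "\<And>w. w \<in> S \<Longrightarrow> G w = (w - z) ^ m * u w"
        using holomorphic_divide_out_zero[OF less.prems(1) assms(2,3) _ less.prems(2), of z]
          z assms(5) by blast
      \<comment> \<open>Every zero of \<open>u\<close> is a zero of \<open>G\<close>, and
        \<open>z\<close> is no longer one.\<close>
      have "{w\<in>K. u w = 0} \<subset> {w\<in>K. G w = 0}"
        using u assms(5) z by auto
      then have "card {w\<in>K. u w = 0} < card {w\<in>K. G w = 0}"
        using fin by (rule psubset_card_mono[rotated])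
      moreover have "\<exists>w\<in>S. u w \<noteq> 0" using u(2) z assms(5) by blast
      ultimately obtain zs v where v: "set zs \<subseteq> K" "v holomorphic_on S" "\<forall>w\<in>K. v w \<noteq> 0"
        "\<forall>w\<in>S. u w = poly (zeros_poly zs) w * v w"
        using less.hyps[OF _ u(1)] by blast
      show ?thesis
        using v z u(3)
        by (intro exI[of _ "replicate m z @ zs"] exI[of _ v])
           (auto simp: zeros_poly_replicate_append)
    qed
  qed
  then show ?thesis using that by blast
qed

text \<open>At a radius \<open>r\<close> strictly between 1 and \<open>R\<close> the terms of the
  convergent Taylor series are bounded, which is decay at rate \<open>1 / r\<close>.\<close>

lemma rapid_decay_fps_expansion:
  assumes "f holomorphic_on ball 0 R" "R > 1"
  shows "rapid_decay (fps_expansion f 0)"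
proof -
  define r where "r = (1 + R) / 2"
  have r: "1 < r" "r < R" using assms(2) by (auto simp: r_def)
  have "(\<lambda>n. (deriv ^^ n) f 0 / fact n * (of_real r - 0) ^ n) sums f (of_real r)"
    using r by (intro holomorphic_power_series[OF assms(1)]) auto
  then have "(\<lambda>n. fps_nth (fps_expansion f 0) n * of_real r ^ n) \<longlonglongrightarrow> 0"
    using summable_LIMSEQ_zero[OF sums_summable] by (simp add: fps_expansion_def)
  then obtain C where C: "\<And>n. norm (fps_nth (fps_expansion f 0) n * of_real r ^ n) \<le> C"
    using convergent_imp_Bseq[THEN BseqD] convergentI by blast
  have "C \<ge> 0" using C[of 0] norm_ge_zero order_trans by blast
  moreover have "cmod (fps_nth (fps_expansion f 0) n) \<le> C * (1 / r) ^ n" for n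
    using C[of n] r by (simp add: norm_mult norm_power field_simps)
  ultimately show ?thesis
    unfolding rapid_decay_def using r by (intro exI[of _ C] exI[of _ "1 / r"]) auto
qed

lemma has_fps_expansion_poly: "poly p has_fps_expansion fps_of_poly (p :: complex poly)"
proof (induction p)
  case 0
  then show ?case by simp
next
  case (pCons a p)
  have "(\<lambda>z. a + z * poly p z) has_fps_expansion fps_const a + fps_X * fps_of_poly p"
    by (intro fps_expansion_intros pCons)
  then show ?case by (simp add: fps_of_poly_pCons mult.commute add.commute)
qed

text \<open>\<open>U\<close> is the expansion of the zero-free factor \<open>u\<close> and
  \<open>V\<close> that of \<open>1 / u\<close>; the last conjunct records the nonzero values of
  \<open>1 / u\<close> on the circle. This collects the facts that the coefficient estimates take
  from complex analysis.\<close>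

definition disk_factorization ::
  "(complex \<Rightarrow> complex) \<Rightarrow> (complex \<Rightarrow> complex) \<Rightarrow> complex list \<Rightarrow> complex fps \<Rightarrow> complex fps \<Rightarrow> bool"
  where
  "disk_factorization g G zs U V \<longleftrightarrow>
     g has_fps_expansion fps_of_poly (zeros_poly zs) * U \<and>
     (\<forall>z. z \<in> set zs \<longleftrightarrow> cmod z = 1 \<and> G z = 0) \<and>
     U * V = 1 \<and> rapid_decay U \<and> rapid_decay V \<and>
     rapid_decay (fps_of_poly (zeros_poly zs) * U) \<and>
     (\<forall>z. cmod z = 1 \<longrightarrow> (\<exists>c. c \<noteq> 0 \<and> (\<lambda>k. fps_nth V k * z ^ k) sums c))"

text \<open>The zeros in the closed disk are all on the circle, since \<open>g\<close> has none
  inside. Once they are divided out, \<open>u\<close> is nonzero on an open neighbourhood of the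
  closed disk, so \<open>1 / u\<close> is also holomorphic on a disk of radius greater than
  1.\<close>

lemma disk_factorization_exists:
  assumes "closed_disk_continuation g G" and nz: "\<forall>z\<in>ball 0 1. g z \<noteq> 0"
  shows "\<exists>zs U V. disk_factorization g G zs U V"
proof -
  from assms obtain D where D: "open D" "cball 0 1 \<subseteq> D" "G holomorphic_on D"
    and Gg: "\<forall>z\<in>ball 0 1. G z = g z"
    unfolding closed_disk_continuation_def by blast
  obtain R where R: "R > 1" "ball 0 R \<subseteq> D"
    using cball_nbhd_obtains_ball[OF D(1,2)] by blast
  have hol: "G holomorphic_on ball 0 R" using D(3) R(2) by (rule holomorphic_on_subset)
  have sub: "cball 0 1 \<subseteq> ball (0::complex) R" using R by auto
  have nz': "\<exists>w\<in>ball 0 R. G w \<noteq> 0"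
    using nz Gg R by (intro bexI[of _ 0]) auto
  obtain zs u where u: "set zs \<subseteq> cball 0 1" "u holomorphic_on ball 0 R"
    "\<And>w. w \<in> cball 0 1 \<Longrightarrow> u w \<noteq> 0"
    "\<And>w. w \<in> ball 0 R \<Longrightarrow> G w = poly (zeros_poly zs) w * u w"
    using holomorphic_zeros_factorization[OF hol open_ball connected_ball compact_cball sub _ nz']
    by auto
  have root: "poly (zeros_poly zs) z = 0 \<longleftrightarrow> z \<in> set zs" for z
    by (induction zs) auto
  define v where "v z = inverse (u z)" for z
  define W where "W = ball 0 R \<inter> u -` (-{0})"
  have W: "open W" "cball 0 1 \<subseteq> W"
    unfolding W_def using u(3) sub
    by (auto intro!: continuous_open_preimage holomorphic_on_imp_continuous_on u(2))
  obtain r where r: "r > 1" "ball 0 r \<subseteq> W"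
    using cball_nbhd_obtains_ball[OF W] by blast
  have hv: "v holomorphic_on ball 0 r"
    unfolding v_def using r(2)
    by (intro holomorphic_intros holomorphic_on_subset[OF u(2)]) (auto simp: W_def)
  define U where "U = fps_expansion u 0"
  define V where "V = fps_expansion v 0"
  have eU: "u has_fps_expansion U"
    unfolding U_def using R by (intro has_fps_expansion_fps_expansion[OF open_ball _ u(2)]) auto
  have eV: "v has_fps_expansion V"
    unfolding V_def using r by (intro has_fps_expansion_fps_expansion[OF open_ball _ hv]) auto
  have eG: "(\<lambda>z. poly (zeros_poly zs) z * u z) has_fps_expansion fps_of_poly (zeros_poly zs) * U"
    by (intro fps_expansion_intros has_fps_expansion_poly eU)
  have ev: "eventually (\<lambda>z. z \<in> ball 0 1) (nhds (0::complex))"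
    by (intro eventually_nhds_in_open) auto
  have "disk_factorization g G zs U V"
    unfolding disk_factorization_def
  proof (intro conjI allI impI)
    fix z
    have "cmod z = 1 \<and> G z = 0" if z: "z \<in> set zs"
    proof -
      have "G z = 0" using u(4)[of z] root z u(1) sub by auto
      then have "z \<notin> ball 0 1" using nz Gg by auto
      with \<open>G z = 0\<close> show ?thesis using z u(1) by auto
    qed
    moreover have "z \<in> set zs" if "cmod z = 1" "G z = 0"
      using that u(3)[of z] u(4)[of z] root R(1) by auto
    ultimately show "z \<in> set zs \<longleftrightarrow> cmod z = 1 \<and> G z = 0" by blast
  next
    \<comment> \<open>\<open>G\<close> and \<open>g\<close> agree near 0, so the expansion of the
      factorised \<open>G\<close> is that of \<open>g\<close>.\<close>
    note eG
    moreover have "eventually (\<lambda>z. g z = poly (zeros_poly zs) z * u z) (nhds 0)"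
      using ev by eventually_elim (use Gg u(4) R in auto)
    ultimately show "g has_fps_expansion fps_of_poly (zeros_poly zs) * U"
      by (subst has_fps_expansion_cong) auto
  next
    have "(\<lambda>z. u z * v z) has_fps_expansion U * V"
      by (intro fps_expansion_intros eU eV)
    moreover have "eventually (\<lambda>z. u z * v z = 1) (nhds 0)"
      using ev by eventually_elim (use u(3) in \<open>auto simp: v_def\<close>)
    ultimately have "(\<lambda>z. 1) has_fps_expansion U * V"
      by (subst (asm) has_fps_expansion_cong) auto
    then show "U * V = 1"
      using fps_expansion_unique_complex has_fps_expansion_1 by blast
  next
    show "rapid_decay U"
      unfolding U_def by (rule rapid_decay_fps_expansion[OF u(2) R(1)])
  next
    show "rapid_decay V"
      unfolding V_def by (rule rapid_decay_fps_expansion[OF hv r(1)])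
  next
    have "(\<lambda>z. poly (zeros_poly zs) z * u z) holomorphic_on ball 0 R"
      by (intro holomorphic_intros u(2))
    then show "rapid_decay (fps_of_poly (zeros_poly zs) * U)"
      using rapid_decay_fps_expansion[OF _ R(1)] fps_expansion_eqI[OF eG] by metis
  next
    fix z :: complex assume z: "cmod z = 1"
    have "(\<lambda>n. (deriv ^^ n) v 0 / fact n * (z - 0) ^ n) sums v z"
      using r z by (intro holomorphic_power_series[OF hv]) auto
    moreover have "v z \<noteq> 0" using u(3)[of z] z by (simp add: v_def)
    ultimately show "\<exists>c. c \<noteq> 0 \<and> (\<lambda>k. fps_nth V k * z ^ k) sums c"
      by (intro exI[of _ "v z"]) (simp add: V_def fps_expansion_def)
  qed
  then show ?thesis by blast
qed

subsection \<open>Estimates in one variable\<close>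

lemma flat_uminus: "flat \<alpha> F A B \<Longrightarrow> flat \<alpha> (- F) A B"
  by (simp add: flat_def)

text \<open>On the circle \<open>inverse z\<close> is the conjugate of \<open>z\<close>, so this is
  the section of degree \<open>N\<close> of the reproducing kernel at \<open>z\<close>, divided by
  its value \<open>kernel_sum \<alpha> N\<close> there.\<close>

definition kernel_poly :: "real \<Rightarrow> nat \<Rightarrow> complex \<Rightarrow> complex poly" where
  "kernel_poly \<alpha> N z =
     (\<Sum>k\<le>N. monom (inverse z ^ k * of_real (1 / weight \<alpha> k / kernel_sum \<alpha> N)) k)"

lemma coeff_kernel_poly:
  "coeff (kernel_poly \<alpha> N z) k =
     (if k \<le> N then inverse z ^ k * of_real (1 / weight \<alpha> k / kernel_sum \<alpha> N) else 0)"
  by (simp add: kernel_poly_def coeff_sum)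

lemma degree_kernel_poly: "degree (kernel_poly \<alpha> N z) \<le> N"
  by (rule degree_le) (auto simp: coeff_kernel_poly)

lemma poly_kernel_poly:
  assumes "z \<noteq> 0"
  shows "poly (kernel_poly \<alpha> N z) z = 1"
proof -
  have "poly (kernel_poly \<alpha> N z) z = (\<Sum>k\<le>N. of_real (1 / weight \<alpha> k / kernel_sum \<alpha> N))"
    unfolding kernel_poly_def poly_sum poly_monom
  proof (intro sum.cong refl)
    fix k
    have "inverse z ^ k * z ^ k = 1"
      using assms by (simp flip: power_mult_distrib)
    then show "inverse z ^ k * of_real (1 / weight \<alpha> k / kernel_sum \<alpha> N) * z ^ k
        = of_real (1 / weight \<alpha> k / kernel_sum \<alpha> N)"
      by (metis mult.commute mult.left_commute mult.right_neutral)
  qed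
  also have "\<dots> = of_real (kernel_sum \<alpha> N / kernel_sum \<alpha> N)"
    unfolding of_real_sum[symmetric] sum_divide_distrib[symmetric] kernel_sum_def ..
  also have "\<dots> = 1" by simp
  finally show ?thesis .
qed

text \<open>The coefficients have modulus \<open>1 / (weight k * kernel_sum N)\<close>: their sum is
  normalised to 1, and multiplying by the weight makes them constant up to degree
  \<open>N\<close>.\<close>

lemma flat_kernel_poly:
  assumes "cmod z = 1"
  shows "flat \<alpha> (fps_of_poly (kernel_poly \<alpha> N z)) 1 (1 / kernel_sum \<alpha> N)"
proof -
  have n: "cmod (coeff (kernel_poly \<alpha> N z) k) =
      (if k \<le> N then 1 / weight \<alpha> k / kernel_sum \<alpha> N else 0)" for k
    using assms weight_pos[of \<alpha> k] kernel_sum_pos[of \<alpha> N]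
    by (simp add: coeff_kernel_poly norm_mult norm_power norm_inverse norm_divide abs_of_pos)
  show ?thesis
    unfolding flat_def fps_of_poly_nth n
  proof (intro conjI allI)
    fix K
    have "(\<Sum>k<K. if k \<le> N then 1 / weight \<alpha> k / kernel_sum \<alpha> N else 0)
        = (\<Sum>k\<in>{..<K} \<inter> {..N}. 1 / weight \<alpha> k / kernel_sum \<alpha> N)"
      by (subst sum.inter_restrict) auto
    also have "\<dots> \<le> (\<Sum>k\<le>N. 1 / weight \<alpha> k / kernel_sum \<alpha> N)"
      using kernel_sum_pos[of \<alpha> N] by (intro sum_mono2) (auto intro!: divide_nonneg_pos)
    also have "\<dots> = 1"
      unfolding sum_divide_distrib[symmetric] kernel_sum_def[symmetric] by simp
    finally show "(\<Sum>k<K. if k \<le> N then 1 / weight \<alpha> k / kernel_sum \<alpha> N else 0) \<le> 1" .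
  next
    fix k
    show "weight \<alpha> k * (if k \<le> N then 1 / weight \<alpha> k / kernel_sum \<alpha> N else 0)
        \<le> 1 / kernel_sum \<alpha> N"
      using weight_pos[of \<alpha> k] kernel_sum_pos[of \<alpha> N] by simp
  qed
qed

text \<open>Only indices \<open>k > N\<close> survive, and there
  \<open>kernel_sum \<alpha> N\<close> is at most a power of \<open>k + 1\<close>, which exponential
  decay beats.\<close>

lemma flat_truncation:
  assumes "\<alpha> \<le> 1" "rapid_decay V"
  obtains A B where
    "\<And>N. flat \<alpha> (fps_of_poly (truncate_fps (Suc N) V) - V) A (B / kernel_sum \<alpha> N)"
proof -
  obtain b :: nat where b: "\<bar>\<alpha>\<bar> \<le> real b"
    using real_arch_simple by blast
  obtain A where A: "\<And>K. (\<Sum>k<K. real (k + 1) ^ 0 * cmod (fps_nth V k)) \<le> A"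
    using rapid_decay_weighted_sums[OF assms(2)] by blast
  \<comment> \<open>One power of \<open>k + 1\<close> for the weight and \<open>b + 1\<close> powers
    for \<open>kernel_sum\<close>.\<close>
  obtain B where B: "\<And>K. (\<Sum>k<K. real (k + 1) ^ (b + 2) * cmod (fps_nth V k)) \<le> B"
    using rapid_decay_weighted_sums[OF assms(2)] by blast
  have B0: "B \<ge> 0" using B[of 0] by simp
  have nth: "cmod (fps_nth (fps_of_poly (truncate_fps (Suc N) V) - V) k) =
      (if k \<le> N then 0 else cmod (fps_nth V k))" for N k
    by (simp add: coeff_truncate_fps less_Suc_eq_le)
  have "flat \<alpha> (fps_of_poly (truncate_fps (Suc N) V) - V) A (B / kernel_sum \<alpha> N)" for N
    unfolding flat_def nth
  proof (intro conjI allI)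
    fix K
    have "(\<Sum>k<K. if k \<le> N then 0 else cmod (fps_nth V k)) \<le> (\<Sum>k<K. cmod (fps_nth V k))"
      by (intro sum_mono) auto
    with A[of K] show "(\<Sum>k<K. if k \<le> N then 0 else cmod (fps_nth V k)) \<le> A" by simp
  next
    fix k
    show "weight \<alpha> k * (if k \<le> N then 0 else cmod (fps_nth V k)) \<le> B / kernel_sum \<alpha> N"
    proof (cases "k \<le> N")
      case True
      then show ?thesis using B0 by simp
    next
      case False
      have "kernel_sum \<alpha> N \<le> real (k + 1) ^ Suc b"
        using kernel_sum_mono[of N k \<alpha>] kernel_sum_le_power[OF b, of k] False by linarith
      then have "weight \<alpha> k * cmod (fps_nth V k) * kernel_sum \<alpha> N
          \<le> real (k + 1) * cmod (fps_nth V k) * real (k + 1) ^ Suc b"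
        using weight_le_Suc[OF assms(1), of k] kernel_sum_pos[of \<alpha> N]
        by (intro mult_mono) auto
      also have "\<dots> = real (k + 1) ^ (b + 2) * cmod (fps_nth V k)"
        by (simp add: mult_ac)
      also have "\<dots> \<le> (\<Sum>k<Suc k. real (k + 1) ^ (b + 2) * cmod (fps_nth V k))"
        by (intro member_le_sum) auto
      also have "\<dots> \<le> B" by (rule B)
      finally show ?thesis
        using False kernel_sum_pos[of \<alpha> N] by (simp add: pos_le_divide_eq)
    qed
  qed
  then show ?thesis by (rule that)
qed

text \<open>The normalisation of the kernel at \<open>z\<close> makes \<open>z\<close> a root of its
  complement. The quotient \<open>t\<close> is an approximate reciprocal of the linear
  factor.\<close>

lemma kernel_poly_complement_factor:
  assumes "z \<noteq> 0"
  obtains t where "[:- z, 1:] * t = 1 - kernel_poly \<alpha> N z" "degree t \<le> N"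
proof -
  have "poly (1 - kernel_poly \<alpha> N z) z = 0"
    using poly_kernel_poly[OF assms] by simp
  then obtain t where t: "1 - kernel_poly \<alpha> N z = [:- z, 1:] * t"
    unfolding poly_eq_0_iff_dvd by (elim dvdE)
  have "degree t \<le> N"
  \<comment> \<open>The case \<open>t = 0\<close> does occur: for \<open>N = 0\<close> the kernel is
    the constant 1.\<close>
  proof (cases "t = 0")
    case False
    then have "degree t \<le> degree (1 - kernel_poly \<alpha> N z)"
      unfolding t by (simp add: degree_mult_eq del: mult_pCons_left)
    also have "\<dots> \<le> N" using degree_kernel_poly by (intro degree_diff_le) auto
    finally show ?thesis .
  qed simp
  with t show ?thesis using that by simp
qed

text \<open>Induction over the zeros, with \<open>A\<close> and \<open>B\<close> independent of
  \<open>N\<close>. Each zero multiplies \<open>p\<close> by a quotient \<open>t\<close> and turns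
  \<open>1 + E\<close> into \<open>(1 + E) * (1 + r)\<close>, where \<open>- r\<close> is the kernel
  at that zero; the degree grows by at most \<open>N\<close>.\<close>

lemma polynomial_near_inverse:
  assumes "\<alpha> \<le> 1" "U * V = 1" "rapid_decay U" "rapid_decay V"
    and "\<And>z. z \<in> set zs \<Longrightarrow> cmod z = 1"
  shows "\<exists>A B. \<forall>N. \<exists>p. degree p \<le> (length zs + 1) * N \<and>
    flat \<alpha> (fps_of_poly p * (fps_of_poly (zeros_poly zs) * U) - 1) A (B / kernel_sum \<alpha> N)"
  using assms(5)
proof (induction zs)
  case Nil
  obtain A B where AB:
    "\<And>N. flat \<alpha> (fps_of_poly (truncate_fps (Suc N) V) - V) A (B / kernel_sum \<alpha> N)"
    using flat_truncation[OF assms(1,4)] by blast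
  obtain M where "\<And>K. (\<Sum>k<K. real (k + 1) ^ 1 * cmod (fps_nth U k)) \<le> M"
    using rapid_decay_weighted_sums[OF assms(3)] by blast
  then have M: "\<And>K. (\<Sum>k<K. real (k + 1) * cmod (fps_nth U k)) \<le> M" by simp
  show ?case
  proof (intro exI allI conjI)
    fix N
    show "degree (truncate_fps (Suc N) V) \<le> (length [] + 1) * N"
      using degree_truncate_fps[of "Suc N" V] by simp
    \<comment> \<open>As \<open>U * V = 1\<close>, the error is \<open>U\<close> times the
      truncation error of \<open>V\<close>.\<close>
    have "U * (fps_of_poly (truncate_fps (Suc N) V) - V)
        = fps_of_poly (truncate_fps (Suc N) V) * (fps_of_poly (zeros_poly []) * U) - 1"
      using assms(2) by (simp add: algebra_simps)
    with flat_multiplier[OF assms(1) M AB[of N]]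
    show "flat \<alpha> (fps_of_poly (truncate_fps (Suc N) V) * (fps_of_poly (zeros_poly []) * U) - 1)
        (M * A) (M * B / kernel_sum \<alpha> N)" by simp
  qed
next
  case (Cons z zs)
  have "\<And>x. x \<in> set zs \<Longrightarrow> cmod x = 1" using Cons.prems by simp
  from Cons.IH[OF this] obtain A B where IH: "\<And>N. \<exists>p. degree p \<le> (length zs + 1) * N \<and>
    flat \<alpha> (fps_of_poly p * (fps_of_poly (zeros_poly zs) * U) - 1) A (B / kernel_sum \<alpha> N)"
    by blast
  have z: "cmod z = 1" using Cons.prems by simp
  show ?case
  \<comment> \<open>These are the bounds for \<open>E + r + E * r\<close>, where \<open>E\<close>
    has bounds \<open>A\<close>, \<open>B / ?S\<close> and \<open>r\<close> has bounds 1,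
    \<open>1 / ?S\<close>.\<close>
  proof (rule exI[of _ "A + 1 + A * 1"], rule exI[of _ "2 * B + A + 1"], rule allI)
    fix N
    let ?S = "kernel_sum \<alpha> N"
    obtain p where p: "degree p \<le> (length zs + 1) * N"
      "flat \<alpha> (fps_of_poly p * (fps_of_poly (zeros_poly zs) * U) - 1) A (B / ?S)"
      using IH by blast
    obtain t where t: "[:- z, 1:] * t = 1 - kernel_poly \<alpha> N z" "degree t \<le> N"
      using kernel_poly_complement_factor[of z \<alpha> N] z norm_zero zero_neq_one by metis
    define E where "E = fps_of_poly p * (fps_of_poly (zeros_poly zs) * U) - 1"
    define r where "r = - fps_of_poly (kernel_poly \<alpha> N z)"
    have r: "flat \<alpha> r 1 (1 / ?S)"
      unfolding r_def by (intro flat_uminus flat_kernel_poly z)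
    have "flat \<alpha> (E + r + E * r) (A + 1 + A * 1) (B / ?S + 1 / ?S + (1 * (B / ?S) + A * (1 / ?S)))"
      using p(2) r unfolding E_def by (intro flat_add flat_mult assms(1))
    also have "E + r + E * r = (1 + E) * (1 + r) - 1" by (simp add: algebra_simps)
    also have "1 + r = fps_of_poly ([:- z, 1:] * t)"
      by (simp add: t(1) r_def fps_of_poly_diff del: mult_pCons_left)
    also have "(1 + E) * fps_of_poly ([:- z, 1:] * t) - 1
        = fps_of_poly (p * t) * (fps_of_poly (zeros_poly (z # zs)) * U) - 1"
      unfolding E_def zeros_poly_simps fps_of_poly_mult by (simp add: mult_ac)
    also have "B / ?S + 1 / ?S + (1 * (B / ?S) + A * (1 / ?S)) = (2 * B + A + 1) / ?S"
      by (simp add: add_divide_distrib)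
    finally have "flat \<alpha> (fps_of_poly (p * t) * (fps_of_poly (zeros_poly (z # zs)) * U) - 1)
        (A + 1 + A * 1) ((2 * B + A + 1) / ?S)" .
    moreover have "degree (p * t) \<le> (length (z # zs) + 1) * N"
      using degree_mult_le[of p t] p(1) t(2) by simp
    ultimately show "\<exists>p. degree p \<le> (length (z # zs) + 1) * N \<and>
        flat \<alpha> (fps_of_poly p * (fps_of_poly (zeros_poly (z # zs)) * U) - 1)
        (A + 1 + A * 1) ((2 * B + A + 1) / ?S)" by blast
  qed
qed

text \<open>\<open>c\<close> and \<open>e\<close> are fixed before \<open>n\<close>,
  \<open>p\<close> and \<open>B\<close>. The shift \<open>e\<close> makes the truncation degree
  \<open>n + e\<close> large enough both to contain \<open>p * Q\<close> and to bring the partial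
  sum of \<open>V\<close> at \<open>z\<close> close to \<open>c0\<close>.\<close>

lemma dnorm_lower_bound:
  assumes "\<alpha> \<le> 1" "U * V = 1" "rapid_decay V"
    and z: "cmod z = 1" "z \<in> set zs"
    and c0: "(\<lambda>k. fps_nth V k * z ^ k) sums c0" "c0 \<noteq> 0"
  shows "\<exists>c>0. \<exists>e. \<forall>n p B. degree p \<le> n \<longrightarrow>
    dnorm_bound \<alpha> (fps_of_poly p * (fps_of_poly (zeros_poly zs) * U) - 1) B \<longrightarrow>
    c / kernel_sum \<alpha> (n + e) \<le> B"
proof -
  define Q where "Q = zeros_poly zs"
  have Qz: "poly Q z = 0" unfolding Q_def using z(2) by (induction zs) auto
  obtain M where "\<And>K. (\<Sum>k<K. real (k + 1) ^ 1 * cmod (fps_nth V k)) \<le> M"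
    using rapid_decay_weighted_sums[OF assms(3)] by blast
  then have M0: "(\<Sum>k<K. real (k + 1) * cmod (fps_nth V k)) \<le> M" for K by simp
  \<comment> \<open>Enlarged by 1 so that \<open>c\<close> can have a positive denominator.\<close>
  have M: "(\<Sum>k<K. real (k + 1) * cmod (fps_nth V k)) \<le> M + 1" for K
    using M0[of K] by linarith
  have "M \<ge> 0" using M0[of 0] by simp
  have "(\<lambda>K. cmod (\<Sum>k<K. fps_nth V k * z ^ k)) \<longlonglongrightarrow> cmod c0"
    using c0(1) unfolding sums_def by (rule tendsto_norm)
  then have "eventually (\<lambda>K. cmod (\<Sum>k<K. fps_nth V k * z ^ k) > cmod c0 / 2) sequentially"
    by (rule order_tendstoD) (use c0(2) in simp)
  then obtain K0 where K0: "\<And>K. K \<ge> K0 \<Longrightarrow> cmod (\<Sum>k<K. fps_nth V k * z ^ k) > cmod c0 / 2"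
    unfolding eventually_sequentially by blast
  \<comment> \<open>\<open>cmod c0 / 2\<close> bounds late partial sums of \<open>V\<close> at
    \<open>z\<close> from below, and \<open>(M + 1)^2\<close> is the cost of multiplying the error
    by \<open>V\<close>.\<close>
  define c where "c = (cmod c0 / 2)\<^sup>2 / (M + 1)\<^sup>2"
  show ?thesis
  proof (intro exI[of _ c] conjI exI[of _ "K0 + degree Q"] allI impI)
    show "c > 0" using c0(2) \<open>M \<ge> 0\<close> by (simp add: c_def)
  next
    fix n p B
    assume deg: "degree p \<le> n"
      and B: "dnorm_bound \<alpha> (fps_of_poly p * (fps_of_poly (zeros_poly zs) * U) - 1) B"
    define D where "D = n + (K0 + degree Q)"
    define X where "X k = coeff (p * Q) k - fps_nth V k" for k
    have "V * (fps_of_poly p * (fps_of_poly Q * U) - 1) = fps_of_poly (p * Q) * (U * V) - V"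
      by (simp add: fps_of_poly_mult algebra_simps)
    then have VF: "V * (fps_of_poly p * (fps_of_poly Q * U) - 1) = fps_of_poly (p * Q) - V"
      using assms(2) by simp
    have "dnorm_bound \<alpha> (fps_of_poly (p * Q) - V) ((M + 1)\<^sup>2 * B)"
      using dnorm_bound_multiplier[OF assms(1) M B] unfolding Q_def[symmetric] VF .
    then have X2: "(\<Sum>k<Suc D. weight \<alpha> k * (cmod (X k))\<^sup>2) \<le> (M + 1)\<^sup>2 * B"
      unfolding dnorm_bound_def X_def by (simp del: sum.lessThan_Suc)
    \<comment> \<open>\<open>D\<close> is at least the degree of \<open>p * Q\<close>, so the
      truncation keeps the whole polynomial and its root \<open>z\<close> kills the sum.\<close>
    have "poly (p * Q) z = (\<Sum>k<Suc D. coeff (p * Q) k * z ^ k)"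
      unfolding poly_altdef
      using degree_mult_le[of p Q] deg
      by (intro sum.mono_neutral_left) (auto simp: D_def coeff_eq_0)
    then have "(\<Sum>k<Suc D. coeff (p * Q) k * z ^ k) = 0" using Qz by simp
    then have XT: "(\<Sum>k<Suc D. X k * z ^ k) = - (\<Sum>k<Suc D. fps_nth V k * z ^ k)"
      by (simp add: X_def left_diff_distrib sum_subtractf del: sum.lessThan_Suc)
    have "cmod c0 / 2 \<le> cmod (\<Sum>k<Suc D. X k * z ^ k)"
      unfolding XT norm_minus_cancel using K0[of "Suc D"] by (simp add: D_def)
    also have "\<dots> \<le> (\<Sum>k<Suc D. cmod (X k))"
      by (rule order_trans[OF norm_sum]) (simp add: norm_mult norm_power z(1) del: sum.lessThan_Suc)
    \<comment> \<open>Inserting the weights prepares Cauchy-Schwarz, whose second factor becomes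
      \<open>kernel_sum \<alpha> D\<close>.\<close>
    also have "\<dots> = (\<Sum>k<Suc D. (sqrt (weight \<alpha> k) * cmod (X k)) * sqrt (1 / weight \<alpha> k))"
      by (intro sum.cong refl) (simp add: real_sqrt_divide)
    finally have "(cmod c0 / 2)\<^sup>2
        \<le> (\<Sum>k<Suc D. (sqrt (weight \<alpha> k) * cmod (X k)) * sqrt (1 / weight \<alpha> k))\<^sup>2"
      by (intro power_mono) auto
    also have "\<dots> \<le> (\<Sum>k<Suc D. (sqrt (weight \<alpha> k) * cmod (X k))\<^sup>2)
        * (\<Sum>k<Suc D. (sqrt (1 / weight \<alpha> k))\<^sup>2)"
      by (rule Cauchy_Schwarz_ineq_sum)
    also have "\<dots> = (\<Sum>k<Suc D. weight \<alpha> k * (cmod (X k))\<^sup>2) * kernel_sum \<alpha> D"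
      by (simp add: power_mult_distrib kernel_sum_def lessThan_Suc_atMost del: sum.lessThan_Suc)
    also have "\<dots> \<le> (M + 1)\<^sup>2 * B * kernel_sum \<alpha> D"
      using X2 kernel_sum_pos[of \<alpha> D] by (intro mult_right_mono) auto
    finally show "c / kernel_sum \<alpha> (n + (K0 + degree Q)) \<le> B"
      unfolding c_def D_def[symmetric]
      using \<open>M \<ge> 0\<close> kernel_sum_pos[of \<alpha> D] by (simp add: field_simps)
  qed
qed

subsection \<open>The norm on the bidisk\<close>

text \<open>Matches the shape of \<open>taylor_coeff2_mult_minus_one\<close>, so that one-variable
  errors can be recognised in two-variable coefficients.\<close>

lemma fps_monom_sum_mult_nth:
  "fps_nth (fps_of_poly (\<Sum>j\<le>n. monom (d j) j) * F) l
     = (\<Sum>j\<le>n. d j * fps_nth (fps_X ^ j * (F :: complex fps)) l)"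
proof -
  have "fps_of_poly (\<Sum>j\<le>n. monom (d j) j) * F = (\<Sum>j\<le>n. fps_const (d j) * (fps_X ^ j * F))"
    by (simp add: fps_of_poly_sum fps_of_poly_monom sum_distrib_right mult.assoc)
  then show ?thesis
    by (simp add: fps_sum_nth del: fps_X_power_mult_nth)
qed

lemma has_fps_expansion_deriv_iter_0:
  fixes f :: "complex \<Rightarrow> complex"
  assumes "f has_fps_expansion F"
  shows "(deriv ^^ l) f 0 = fact l * fps_nth F l"
  using fps_nth_fps_expansion[OF assms, of l] by simp

text \<open>Two one-variable expansions: with \<open>z1\<close> frozen, \<open>g z1\<close> is a
  scalar, and the coefficient in \<open>z2\<close> is again a finite combination of functions of
  \<open>z1\<close> with known expansions.\<close>

lemma taylor_coeff2_mult_minus_one: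
  assumes g: "g has_fps_expansion F" and h: "h has_fps_expansion H"
  shows "taylor_coeff2 (\<lambda>z1 z2. (\<Sum>i\<le>n. \<Sum>j\<le>n. c i j * z1 ^ i * z2 ^ j) * (g z1 * h z2) - 1) k l
    = (\<Sum>i\<le>n. \<Sum>j\<le>n. c i j * fps_nth (fps_X ^ i * F) k * fps_nth (fps_X ^ j * H) l)
      - (if k = 0 \<and> l = 0 then 1 else 0)"
proof -
  let ?\<delta> = "\<lambda>m. if m = (0::nat) then 1 else 0 :: complex"
  let ?b = "\<lambda>j. fps_nth (fps_X ^ j * H) l" and ?a = "\<lambda>i. fps_nth (fps_X ^ i * F) k"
  \<comment> \<open>The identity holds for every \<open>z1\<close>, so it can be rewritten under the
    outer derivative.\<close>
  have inner: "(deriv ^^ l) (\<lambda>z2. (\<Sum>i\<le>n. \<Sum>j\<le>n. c i j * z1 ^ i * z2 ^ j) * (g z1 * h z2) - 1) 0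
      = (\<Sum>i\<le>n. \<Sum>j\<le>n. (fact l * c i j * ?b j) * (z1 ^ i * g z1)) - fact l * ?\<delta> l" for z1
  proof -
    have "(\<lambda>z2. (\<Sum>i\<le>n. \<Sum>j\<le>n. (c i j * z1 ^ i * g z1) * (z2 ^ j * h z2)) - 1) has_fps_expansion
        (\<Sum>i\<le>n. \<Sum>j\<le>n. fps_const (c i j * z1 ^ i * g z1) * (fps_X ^ j * H)) - 1"
      by (intro fps_expansion_intros h)
    from has_fps_expansion_deriv_iter_0[OF this, of l]
    have "(deriv ^^ l) (\<lambda>z2. (\<Sum>i\<le>n. \<Sum>j\<le>n. (c i j * z1 ^ i * g z1) * (z2 ^ j * h z2)) - 1) 0
        = fact l * ((\<Sum>i\<le>n. \<Sum>j\<le>n. (c i j * z1 ^ i * g z1) * ?b j) - ?\<delta> l)"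
      by (simp only: fps_sub_nth fps_sum_nth fps_mult_left_const_nth fps_one_nth)
    moreover have "(\<lambda>z2. (\<Sum>i\<le>n. \<Sum>j\<le>n. (c i j * z1 ^ i * g z1) * (z2 ^ j * h z2)) - 1)
        = (\<lambda>z2. (\<Sum>i\<le>n. \<Sum>j\<le>n. c i j * z1 ^ i * z2 ^ j) * (g z1 * h z2) - 1)"
      by (intro ext) (simp add: sum_distrib_left sum_distrib_right mult_ac)
    ultimately show ?thesis
      by (simp only: right_diff_distrib sum_distrib_left mult_ac)
  qed
  have "(\<lambda>z1. (\<Sum>i\<le>n. \<Sum>j\<le>n. (fact l * c i j * ?b j) * (z1 ^ i * g z1)) - fact l * ?\<delta> l)
      has_fps_expansion
      (\<Sum>i\<le>n. \<Sum>j\<le>n. fps_const (fact l * c i j * ?b j) * (fps_X ^ i * F)) - fps_const (fact l * ?\<delta> l)"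
    by (intro fps_expansion_intros g)
  from has_fps_expansion_deriv_iter_0[OF this, of k]
  have "taylor_coeff2 (\<lambda>z1 z2. (\<Sum>i\<le>n. \<Sum>j\<le>n. c i j * z1 ^ i * z2 ^ j) * (g z1 * h z2) - 1) k l
      = ((\<Sum>i\<le>n. \<Sum>j\<le>n. (fact l * c i j * ?b j) * ?a i) - fact l * ?\<delta> l * ?\<delta> k) / fact l"
    unfolding taylor_coeff2_def inner
    by (simp add: fps_sum_nth del: fps_X_power_mult_nth)
  also have "(\<Sum>i\<le>n. \<Sum>j\<le>n. (fact l * c i j * ?b j) * ?a i) - fact l * ?\<delta> l * ?\<delta> k
      = fact l * ((\<Sum>i\<le>n. \<Sum>j\<le>n. c i j * ?a i * ?b j) - ?\<delta> l * ?\<delta> k)"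
    by (simp only: right_diff_distrib sum_distrib_left mult_ac)
  finally show ?thesis by simp
qed

section \<open>Exponentially decaying double arrays and finiteness of the norm\<close>

definition rapid_decay2 :: "(nat \<Rightarrow> nat \<Rightarrow> complex) \<Rightarrow> bool" where
  "rapid_decay2 A \<longleftrightarrow>
     (\<exists>C \<rho>. C \<ge> 0 \<and> 0 < \<rho> \<and> \<rho> < 1 \<and> (\<forall>k l. cmod (A k l) \<le> C * \<rho> ^ (k + l)))"

lemma rapid_decay2_add:
  assumes "rapid_decay2 A" "rapid_decay2 B"
  shows "rapid_decay2 (\<lambda>k l. A k l + B k l)"
proof -
  obtain C \<rho> where A: "C \<ge> 0" "0 < \<rho>" "\<rho> < 1" "\<And>k l. cmod (A k l) \<le> C * \<rho> ^ (k + l)"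
    using assms(1) unfolding rapid_decay2_def by blast
  obtain D \<sigma> where B: "D \<ge> 0" "0 < \<sigma>" "\<sigma> < 1" "\<And>k l. cmod (B k l) \<le> D * \<sigma> ^ (k + l)"
    using assms(2) unfolding rapid_decay2_def by blast
  have "cmod (A k l + B k l) \<le> (C + D) * max \<rho> \<sigma> ^ (k + l)" for k l
  proof -
    have "cmod (A k l + B k l) \<le> C * \<rho> ^ (k + l) + D * \<sigma> ^ (k + l)"
      by (intro norm_triangle_le add_mono A B)
    also have "\<dots> \<le> C * max \<rho> \<sigma> ^ (k + l) + D * max \<rho> \<sigma> ^ (k + l)"
      using A(1,2) B(1,2) by (intro add_mono mult_left_mono power_mono) auto
    finally show ?thesis by (simp add: distrib_right)
  qed
  then show ?thesis
    unfolding rapid_decay2_def using A B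
    by (intro exI[of _ "C + D"] exI[of _ "max \<rho> \<sigma>"]) auto
qed

lemma rapid_decay2_zero: "rapid_decay2 (\<lambda>k l. 0)"
  unfolding rapid_decay2_def by (intro exI[of _ 0] exI[of _ "1 / 2"]) auto

lemma rapid_decay2_sum:
  assumes "\<And>x. x \<in> I \<Longrightarrow> rapid_decay2 (A x)"
  shows "rapid_decay2 (\<lambda>k l. \<Sum>x\<in>I. A x k l)"
  using assms
proof (induction I rule: infinite_finite_induct)
  case (insert x I)
  then have "rapid_decay2 (\<lambda>k l. A x k l + (\<Sum>x\<in>I. A x k l))"
    by (intro rapid_decay2_add) auto
  then show ?case using insert.hyps by simp
qed (auto intro: rapid_decay2_zero)

lemma rapid_decay2_tensor:
  assumes "rapid_decay F" "rapid_decay H"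
  shows "rapid_decay2 (\<lambda>k l. c * fps_nth F k * fps_nth H l)"
proof -
  obtain C \<rho> where F: "C \<ge> 0" "0 < \<rho>" "\<rho> < 1" "\<And>k. cmod (fps_nth F k) \<le> C * \<rho> ^ k"
    using assms(1) unfolding rapid_decay_def by blast
  obtain D \<sigma> where H: "D \<ge> 0" "0 < \<sigma>" "\<sigma> < 1" "\<And>k. cmod (fps_nth H k) \<le> D * \<sigma> ^ k"
    using assms(2) unfolding rapid_decay_def by blast
  have "cmod (c * fps_nth F k * fps_nth H l) \<le> (cmod c * C * D) * max \<rho> \<sigma> ^ (k + l)" for k l
  proof -
    have "cmod (c * fps_nth F k * fps_nth H l) = cmod c * (cmod (fps_nth F k) * cmod (fps_nth H l))"
      by (simp add: norm_mult)
    also have "\<dots> \<le> cmod c * ((C * max \<rho> \<sigma> ^ k) * (D * max \<rho> \<sigma> ^ l))"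
      using F H
      by (intro mult_left_mono mult_mono order_trans[OF F(4)] order_trans[OF H(4)] power_mono) auto
    also have "\<dots> = (cmod c * C * D) * max \<rho> \<sigma> ^ (k + l)"
      by (simp add: power_add)
    finally show ?thesis .
  qed
  then show ?thesis
    unfolding rapid_decay2_def using F H
    by (intro exI[of _ "cmod c * C * D"] exI[of _ "max \<rho> \<sigma>"]) auto
qed

lemma rapid_decay_fps_X_power:
  assumes "rapid_decay F"
  shows "rapid_decay (fps_X ^ i * F)"
proof -
  obtain C \<rho> where F: "C \<ge> 0" "0 < \<rho>" "\<rho> < 1" "\<And>k. cmod (fps_nth F k) \<le> C * \<rho> ^ k"
    using assms unfolding rapid_decay_def by blast
  have "cmod (fps_nth (fps_X ^ i * F) k) \<le> C / \<rho> ^ i * \<rho> ^ k" for k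
  proof (cases "k < i")
    case False
    then have "\<rho> ^ k = \<rho> ^ (k - i) * \<rho> ^ i" by (simp flip: power_add)
    then show ?thesis using False F(2) F(4)[of "k - i"] by (simp add: fps_X_power_mult_nth)
  qed (use F in \<open>simp add: fps_X_power_mult_nth\<close>)
  then show ?thesis
    unfolding rapid_decay_def using F
    by (intro exI[of _ "C / \<rho> ^ i"] exI[of _ \<rho>]) auto
qed

lemma rapid_decay_one: "rapid_decay 1"
  unfolding rapid_decay_def by (intro exI[of _ 1] exI[of _ "1 / 2"]) auto

text \<open>Weights are at most \<open>k + 1\<close>, so the double sum is dominated by a product of
  two one-variable sums. This supplies the finiteness that \<open>bidisk_norm_square\<close> asks
  for.\<close>

lemma rapid_decay2_bounded_sums:
  assumes "\<alpha> \<le> 1" "rapid_decay2 A"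
  obtains B where
    "\<And>K. (\<Sum>k<K. \<Sum>l<K. weight \<alpha> k * weight \<alpha> l * (cmod (A k l))\<^sup>2) \<le> B"
proof -
  obtain C \<rho> where A: "C \<ge> 0" "0 < \<rho>" "\<rho> < 1" "\<And>k l. cmod (A k l) \<le> C * \<rho> ^ (k + l)"
    using assms(2) unfolding rapid_decay2_def by blast
  have "0 < \<rho>\<^sup>2" "\<rho>\<^sup>2 < 1" using A by (auto simp: power_less_one_iff)
  then obtain M where M: "\<And>K. (\<Sum>k<K. real (k + 1) ^ 1 * (\<rho>\<^sup>2) ^ k) \<le> M"
    using bounded_sums_power_geometric by blast
  have "(\<Sum>k<K. \<Sum>l<K. weight \<alpha> k * weight \<alpha> l * (cmod (A k l))\<^sup>2) \<le> C\<^sup>2 * M\<^sup>2" for K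
  proof -
    let ?s = "\<lambda>k. real (k + 1) ^ 1 * (\<rho>\<^sup>2) ^ k"
    have "(\<Sum>k<K. \<Sum>l<K. weight \<alpha> k * weight \<alpha> l * (cmod (A k l))\<^sup>2)
        \<le> (\<Sum>k<K. \<Sum>l<K. C\<^sup>2 * (?s k * ?s l))"
    proof (intro sum_mono)
      fix k l :: nat
      have "weight \<alpha> k * weight \<alpha> l * (cmod (A k l))\<^sup>2
          \<le> real (k + 1) * real (l + 1) * (C * \<rho> ^ (k + l))\<^sup>2"
        by (intro mult_mono power_mono weight_le_Suc[OF assms(1)] A) auto
      also have "\<dots> = C\<^sup>2 * (?s k * ?s l)"
        by (simp add: power_mult_distrib power_add power_mult[symmetric] mult_ac)
      finally show "weight \<alpha> k * weight \<alpha> l * (cmod (A k l))\<^sup>2 \<le> C\<^sup>2 * (?s k * ?s l)" .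
    qed
    also have "\<dots> = C\<^sup>2 * ((\<Sum>k<K. ?s k) * (\<Sum>l<K. ?s l))"
      unfolding sum_product by (simp only: sum_distrib_left)
    also have "\<dots> = C\<^sup>2 * (\<Sum>k<K. ?s k)\<^sup>2"
      by (simp only: power2_eq_square)
    also have "\<dots> \<le> C\<^sup>2 * M\<^sup>2"
      using A(2) by (intro mult_left_mono power_mono M sum_nonneg) auto
    finally show ?thesis .
  qed
  then show ?thesis by (rule that)
qed

lemma bidisk_norm_nonneg: "bidisk_norm \<alpha> f \<ge> 0"
  unfolding bidisk_norm_def by (intro real_sqrt_ge_zero infsum_nonneg) auto

text \<open>Bounded square sums force summability, so the \<open>infsum\<close> in
  \<open>bidisk_norm\<close> is not its default 0; the second claim rests on this.\<close>

lemma bidisk_norm_square: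
  assumes "\<And>K. (\<Sum>k<K. \<Sum>l<K. weight \<alpha> k * weight \<alpha> l * (cmod (taylor_coeff2 f k l))\<^sup>2) \<le> B"
  shows "(bidisk_norm \<alpha> f)\<^sup>2 \<le> B"
    and "finite X \<Longrightarrow> (\<Sum>(k, l)\<in>X. weight \<alpha> k * weight \<alpha> l * (cmod (taylor_coeff2 f k l))\<^sup>2)
      \<le> (bidisk_norm \<alpha> f)\<^sup>2"
proof -
  define T where "T = (\<lambda>(k, l). weight \<alpha> k * weight \<alpha> l * (cmod (taylor_coeff2 f k l))\<^sup>2)"
  have T0: "T x \<ge> 0" for x by (cases x) (simp add: T_def)
  have fin: "sum T X \<le> B" if "finite X" for X
  proof -
    \<comment> \<open>Every finite index set fits into a square.\<close>
    have "finite (fst ` X \<union> snd ` X)" using that by simp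
    then obtain K where K: "fst ` X \<union> snd ` X \<subseteq> {..<K}"
      unfolding finite_nat_iff_bounded by blast
    have "X \<subseteq> {..<K} \<times> {..<K}" using K by force
    then have "sum T X \<le> sum T ({..<K} \<times> {..<K})"
      using T0 by (intro sum_mono2) auto
    also have "\<dots> = (\<Sum>k<K. \<Sum>l<K. weight \<alpha> k * weight \<alpha> l * (cmod (taylor_coeff2 f k l))\<^sup>2)"
      by (simp add: sum.cartesian_product T_def)
    also have "\<dots> \<le> B" by (rule assms)
    finally show ?thesis .
  qed
  have sm: "T summable_on UNIV"
    using fin T0 by (intro nonneg_bdd_above_summable_on bdd_aboveI[of _ B]) auto
  have "bidisk_norm \<alpha> f = sqrt (infsum T UNIV)"
    by (simp add: bidisk_norm_def T_def weight_def)
  then have eq: "(bidisk_norm \<alpha> f)\<^sup>2 = infsum T UNIV"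
    using infsum_nonneg[of UNIV T] T0 by simp
  show "(bidisk_norm \<alpha> f)\<^sup>2 \<le> B"
    unfolding eq using sm fin by (intro infsum_le_finite_sums) auto
  show "(\<Sum>(k, l)\<in>X. weight \<alpha> k * weight \<alpha> l * (cmod (taylor_coeff2 f k l))\<^sup>2)
      \<le> (bidisk_norm \<alpha> f)\<^sup>2" if "finite X"
    unfolding eq T_def[symmetric] using sm that T0 by (intro finite_sum_le_infsum) auto
qed

section \<open>The distance and its two bounds\<close>

lemma dist_one_square_le:
  assumes "p \<in> bidisk_polys n" "(bidisk_norm \<alpha> (\<lambda>z1 z2. p z1 z2 * f z1 z2 - 1))\<^sup>2 \<le> B"
  shows "(dist_one \<alpha> f n)\<^sup>2 \<le> B"
proof -
  have bdd: "bdd_below ((\<lambda>p. bidisk_norm \<alpha> (\<lambda>z1 z2. p z1 z2 * f z1 z2 - 1)) ` bidisk_polys n)"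
    by (intro bdd_belowI[of _ 0]) (auto intro: bidisk_norm_nonneg)
  have "dist_one \<alpha> f n \<le> bidisk_norm \<alpha> (\<lambda>z1 z2. p z1 z2 * f z1 z2 - 1)"
    unfolding dist_one_def by (rule cINF_lower[OF bdd assms(1)])
  moreover have "dist_one \<alpha> f n \<ge> 0"
    unfolding dist_one_def using assms(1) by (intro cINF_greatest) (auto intro: bidisk_norm_nonneg)
  ultimately show ?thesis using assms(2) power_mono order_trans by blast
qed

lemma dist_one_square_ge:
  assumes "\<And>p. p \<in> bidisk_polys n \<Longrightarrow> b \<le> (bidisk_norm \<alpha> (\<lambda>z1 z2. p z1 z2 * f z1 z2 - 1))\<^sup>2"
    and "b \<ge> 0"
  shows "b \<le> (dist_one \<alpha> f n)\<^sup>2"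
proof -
  have "bidisk_polys n \<noteq> {}" unfolding bidisk_polys_def by blast
  then have "sqrt b \<le> dist_one \<alpha> f n"
    unfolding dist_one_def using assms(1)
    by (intro cINF_greatest real_le_lsqrt bidisk_norm_nonneg) auto
  then have "(sqrt b)\<^sup>2 \<le> (dist_one \<alpha> f n)\<^sup>2"
    using assms(2) by (intro power_mono) auto
  then show ?thesis using assms(2) by simp
qed

lemma phi_pos: "n \<ge> 1 \<Longrightarrow> phi \<alpha> (real (n + 1)) > 0"
  by (simp add: phi_def less_max_iff_disj)

lemma one_variable_upper:
  assumes "\<alpha> \<le> 1" "closed_disk_continuation g G" "\<forall>z\<in>ball 0 1. g z \<noteq> 0"
  shows "\<exists>F B d. g has_fps_expansion F \<and> B \<ge> 0 \<and> (\<forall>N. \<exists>p. degree p \<le> d * N \<and>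
    dnorm_bound \<alpha> (fps_of_poly p * F - 1) (B / kernel_sum \<alpha> N))"
proof -
  obtain zs U V where "disk_factorization g G zs U V"
    using disk_factorization_exists[OF assms(2,3)] by blast
  then have g: "g has_fps_expansion fps_of_poly (zeros_poly zs) * U"
    "U * V = 1" "rapid_decay U" "rapid_decay V" and zs: "\<And>z. z \<in> set zs \<Longrightarrow> cmod z = 1"
    unfolding disk_factorization_def by auto
  from polynomial_near_inverse[OF assms(1) g(2-4) zs]
  obtain A B where AB: "\<forall>N. \<exists>p. degree p \<le> (length zs + 1) * N \<and>
      flat \<alpha> (fps_of_poly p * (fps_of_poly (zeros_poly zs) * U) - 1) A (B / kernel_sum \<alpha> N)"
    by blast
  \<comment> \<open>At \<open>N = 0\<close> the kernel sum is 1, which shows that \<open>A\<close>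
    and \<open>B\<close> are nonnegative.\<close>
  then obtain p where "flat \<alpha> (fps_of_poly p * (fps_of_poly (zeros_poly zs) * U) - 1) A
      (B / kernel_sum \<alpha> 0)"
    by blast
  from flatD(3,4)[OF this] have "A * B \<ge> 0"
    by (simp add: kernel_sum_def)
  moreover have "\<exists>p. degree p \<le> (length zs + 1) * N \<and>
      dnorm_bound \<alpha> (fps_of_poly p * (fps_of_poly (zeros_poly zs) * U) - 1) (A * B / kernel_sum \<alpha> N)"
    for N
  proof -
    obtain p where p: "degree p \<le> (length zs + 1) * N"
      "flat \<alpha> (fps_of_poly p * (fps_of_poly (zeros_poly zs) * U) - 1) A (B / kernel_sum \<alpha> N)"
      using AB by blast
    from dnorm_bound_flat[OF p(2)] p(1) show ?thesis by auto
  qed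
  ultimately show ?thesis using g(1) by blast
qed

text \<open>With \<open>p g = 1 + X\<close> and \<open>q h = 1 + Y\<close> the error of the product
  is \<open>X Y + X + Y\<close>, and squared norms multiply on tensor products. The 3 comes from
  \<open>(a + b + c)^2 \<le> 3 * (a^2 + b^2 + c^2)\<close>.\<close>

lemma bidisk_norm_product_le:
  assumes g: "g has_fps_expansion F" and h: "h has_fps_expansion H"
    and p: "degree p \<le> n" "dnorm_bound \<alpha> (fps_of_poly p * F - 1) B"
    and q: "degree q \<le> n" "dnorm_bound \<alpha> (fps_of_poly q * H - 1) B'"
  shows "(dist_one \<alpha> (\<lambda>z1 z2. g z1 * h z2) n)\<^sup>2 \<le> 3 * (B * B' + B + B')"
proof (rule dist_one_square_le)
  let ?p = "\<lambda>z1 z2. \<Sum>i\<le>n. \<Sum>j\<le>n. (coeff p i * coeff q j) * z1 ^ i * z2 ^ j"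
  show "?p \<in> bidisk_polys n"
    unfolding bidisk_polys_def by (intro CollectI exI[of _ "\<lambda>i j. coeff p i * coeff q j"]) simp
  let ?f = "\<lambda>z1 z2. ?p z1 z2 * (g z1 * h z2) - 1"
  define X where "X = fps_of_poly p * F - 1"
  define Y where "Y = fps_of_poly q * H - 1"
  let ?\<delta> = "\<lambda>m. if m = (0::nat) then 1 else 0 :: complex"
  have pF: "(\<Sum>i\<le>n. coeff p i * fps_nth (fps_X ^ i * F) k) = fps_nth X k + ?\<delta> k" for k
    using fps_monom_sum_mult_nth[of "coeff p" n F k] poly_as_sum_of_monoms'[OF p(1)]
    by (simp add: X_def)
  have qH: "(\<Sum>j\<le>n. coeff q j * fps_nth (fps_X ^ j * H) l) = fps_nth Y l + ?\<delta> l" for l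
    using fps_monom_sum_mult_nth[of "coeff q" n H l] poly_as_sum_of_monoms'[OF q(1)]
    by (simp add: Y_def)
  have tc: "taylor_coeff2 ?f k l
      = fps_nth X k * fps_nth Y l + fps_nth X k * ?\<delta> l + ?\<delta> k * fps_nth Y l" for k l
  proof -
    have "taylor_coeff2 ?f k l
        = (\<Sum>i\<le>n. \<Sum>j\<le>n. (coeff p i * fps_nth (fps_X ^ i * F) k)
            * (coeff q j * fps_nth (fps_X ^ j * H) l)) - ?\<delta> k * ?\<delta> l"
      unfolding taylor_coeff2_mult_minus_one[OF g h]
      by (simp add: mult_ac del: fps_X_power_mult_nth)
    also have "\<dots> = (fps_nth X k + ?\<delta> k) * (fps_nth Y l + ?\<delta> l) - ?\<delta> k * ?\<delta> l"
      by (simp only: sum_product[symmetric] pF qH)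
    finally show ?thesis by (simp only: algebra_simps) simp
  qed
  have BB: "(\<Sum>k<K. weight \<alpha> k * (cmod (fps_nth X k))\<^sup>2) \<le> B"
    "(\<Sum>k<K. weight \<alpha> k * (cmod (fps_nth Y k))\<^sup>2) \<le> B'" for K
    using p(2) q(2) unfolding dnorm_bound_def X_def Y_def by blast+
  have B0: "B \<ge> 0" "B' \<ge> 0" using BB[of 0] by simp_all
  show "(bidisk_norm \<alpha> ?f)\<^sup>2 \<le> 3 * (B * B' + B + B')"
  proof (rule bidisk_norm_square(1))
    fix K
    let ?x = "\<lambda>k. weight \<alpha> k * (cmod (fps_nth X k))\<^sup>2"
    let ?y = "\<lambda>k. weight \<alpha> k * (cmod (fps_nth Y k))\<^sup>2"
    let ?e = "\<lambda>k. weight \<alpha> k * (cmod (?\<delta> k))\<^sup>2"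
    have e: "(\<Sum>k<K. ?e k) \<le> 1"
    proof -
      have "(\<Sum>k<K. ?e k) = (\<Sum>k<K. if k = 0 then 1 else 0)"
        by (intro sum.cong refl) simp
      then show ?thesis by (simp add: sum.delta)
    qed
    have "(\<Sum>k<K. \<Sum>l<K. weight \<alpha> k * weight \<alpha> l * (cmod (taylor_coeff2 ?f k l))\<^sup>2)
        \<le> (\<Sum>k<K. \<Sum>l<K. 3 * (?x k * ?y l + ?x k * ?e l + ?e k * ?y l))"
    proof (intro sum_mono)
      fix k l
      let ?a = "fps_nth X k * fps_nth Y l" and ?b = "fps_nth X k * ?\<delta> l" and ?c = "?\<delta> k * fps_nth Y l"
      have sq: "(a + b + c)\<^sup>2 \<le> 3 * (a\<^sup>2 + b\<^sup>2 + c\<^sup>2)" for a b c :: real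
        using sum_squares_bound[of a b] sum_squares_bound[of a c] sum_squares_bound[of b c]
        by (simp add: power2_eq_square algebra_simps)
      have "(cmod (?a + ?b + ?c))\<^sup>2 \<le> (cmod ?a + cmod ?b + cmod ?c)\<^sup>2"
        by (intro power_mono norm_triangle_le add_mono) auto
      also have "\<dots> \<le> 3 * ((cmod ?a)\<^sup>2 + (cmod ?b)\<^sup>2 + (cmod ?c)\<^sup>2)" by (rule sq)
      finally have "weight \<alpha> k * weight \<alpha> l * (cmod (taylor_coeff2 ?f k l))\<^sup>2
          \<le> weight \<alpha> k * weight \<alpha> l * (3 * ((cmod ?a)\<^sup>2 + (cmod ?b)\<^sup>2 + (cmod ?c)\<^sup>2))"
        unfolding tc by (intro mult_left_mono) auto
      also have "\<dots> = 3 * (?x k * ?y l + ?x k * ?e l + ?e k * ?y l)"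
        by (simp only: norm_mult power_mult_distrib) (simp only: algebra_simps)
      finally show "weight \<alpha> k * weight \<alpha> l * (cmod (taylor_coeff2 ?f k l))\<^sup>2
          \<le> 3 * (?x k * ?y l + ?x k * ?e l + ?e k * ?y l)" .
    qed
    also have "\<dots> = 3 * ((\<Sum>k<K. ?x k) * (\<Sum>l<K. ?y l) + (\<Sum>k<K. ?x k) * (\<Sum>l<K. ?e l)
        + (\<Sum>k<K. ?e k) * (\<Sum>l<K. ?y l))"
      unfolding sum_product by (simp only: sum.distrib sum_distrib_left distrib_left)
    also have "\<dots> \<le> 3 * (B * B' + B * 1 + 1 * B')"
      using B0 by (intro mult_left_mono add_mono mult_mono BB e sum_nonneg) auto
    finally show "(\<Sum>k<K. \<Sum>l<K. weight \<alpha> k * weight \<alpha> l * (cmod (taylor_coeff2 ?f k l))\<^sup>2)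
        \<le> 3 * (B * B' + B + B')" by simp
  qed
qed

text \<open>Restricting to one coordinate axis costs nothing in norm, so the one-variable obstruction
  survives in two variables.\<close>

lemma bidisk_norm_ge_slice:
  assumes "\<alpha> \<le> 1" and g: "g has_fps_expansion F" and h: "h has_fps_expansion H"
    and decay: "rapid_decay F" "rapid_decay H"
    and P: "P \<in> bidisk_polys n"
  defines "B \<equiv> (bidisk_norm \<alpha> (\<lambda>z1 z2. P z1 z2 * (g z1 * h z2) - 1))\<^sup>2"
  shows "\<exists>p. degree p \<le> n \<and> dnorm_bound \<alpha> (fps_of_poly p * F - 1) B"
    and "\<exists>p. degree p \<le> n \<and> dnorm_bound \<alpha> (fps_of_poly p * H - 1) B"
proof -
  obtain c where c: "P = (\<lambda>z1 z2. \<Sum>k\<le>n. \<Sum>l\<le>n. c k l * z1 ^ k * z2 ^ l)"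
    using P unfolding bidisk_polys_def by blast
  let ?t = "taylor_coeff2 (\<lambda>z1 z2. P z1 z2 * (g z1 * h z2) - 1)"
  have t: "?t k l = (\<Sum>i\<le>n. \<Sum>j\<le>n. c i j * fps_nth (fps_X ^ i * F) k * fps_nth (fps_X ^ j * H) l)
      - (if k = 0 \<and> l = 0 then 1 else 0)" for k l
    unfolding c by (rule taylor_coeff2_mult_minus_one[OF g h])
  \<comment> \<open>Decay makes the norm a genuine sum, so that partial sums bound it from below.
    The constant 1 enters as the tensor product of the series 1 with itself.\<close>
  have "rapid_decay2 (\<lambda>k l. (\<Sum>i\<le>n. \<Sum>j\<le>n. c i j * fps_nth (fps_X ^ i * F) k * fps_nth (fps_X ^ j * H) l)
      + (- 1) * fps_nth 1 k * fps_nth 1 l)"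
    by (intro rapid_decay2_add rapid_decay2_sum rapid_decay2_tensor rapid_decay_fps_X_power decay
        rapid_decay_one)
  also have "(\<lambda>k l. (\<Sum>i\<le>n. \<Sum>j\<le>n. c i j * fps_nth (fps_X ^ i * F) k * fps_nth (fps_X ^ j * H) l)
      + (- 1) * fps_nth 1 k * fps_nth 1 l) = ?t"
    by (intro ext) (simp add: t del: fps_X_power_mult_nth)
  finally obtain B' where B':
    "\<And>K. (\<Sum>k<K. \<Sum>l<K. weight \<alpha> k * weight \<alpha> l * (cmod (?t k l))\<^sup>2) \<le> B'"
    using rapid_decay2_bounded_sums[OF assms(1)] by blast
  note le = bidisk_norm_square(2)[OF B', folded B_def]
  have deg: "degree (\<Sum>j\<le>n. monom (d j) j) \<le> n" for d :: "nat \<Rightarrow> complex"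
    by (intro degree_sum_le) (auto intro: order_trans[OF degree_monom_le])
  \<comment> \<open>This is \<open>P z1 0 * h 0\<close>: for \<open>j > 0\<close> the series
    \<open>fps_X ^ j * H\<close> has no constant term.\<close>
  let ?p = "\<Sum>i\<le>n. monom (\<Sum>j\<le>n. c i j * fps_nth (fps_X ^ j * H) 0) i"
  have "fps_nth (fps_of_poly ?p * F - 1) k = ?t k 0" for k
    unfolding fps_sub_nth fps_monom_sum_mult_nth t
    by (simp add: sum_distrib_left sum_distrib_right mult_ac del: fps_X_power_mult_nth)
  moreover have "(\<Sum>k<K. weight \<alpha> k * (cmod (?t k 0))\<^sup>2) \<le> B" for K
    using le[of "{..<K} \<times> {0}"] by (simp add: sum.cartesian_product[symmetric])
  ultimately have p: "dnorm_bound \<alpha> (fps_of_poly ?p * F - 1) B"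
    unfolding dnorm_bound_def by simp
  show "\<exists>p. degree p \<le> n \<and> dnorm_bound \<alpha> (fps_of_poly p * F - 1) B"
    by (rule exI, rule conjI, rule deg, rule p)
  \<comment> \<open>Likewise \<open>g 0 * P 0 z2\<close>.\<close>
  let ?q = "\<Sum>j\<le>n. monom (\<Sum>i\<le>n. c i j * fps_nth (fps_X ^ i * F) 0) j"
  have swap: "(\<Sum>j\<le>n. (\<Sum>i\<le>n. c i j * a i) * b j) = (\<Sum>i\<le>n. \<Sum>j\<le>n. c i j * a i * b j)"
    for a b :: "nat \<Rightarrow> complex"
    unfolding sum_distrib_right by (rule sum.swap)
  have "fps_nth (fps_of_poly ?q * H - 1) l = ?t 0 l" for l
    unfolding fps_sub_nth fps_monom_sum_mult_nth t swap by simp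
  moreover have "(\<Sum>l<K. weight \<alpha> l * (cmod (?t 0 l))\<^sup>2) \<le> B" for K
    using le[of "{0} \<times> {..<K}"] by (simp add: sum.cartesian_product[symmetric])
  ultimately have q: "dnorm_bound \<alpha> (fps_of_poly ?q * H - 1) B"
    unfolding dnorm_bound_def by simp
  show "\<exists>p. degree p \<le> n \<and> dnorm_bound \<alpha> (fps_of_poly p * H - 1) B"
    by (rule exI, rule conjI, rule deg, rule q)
qed

text \<open>The shift is a case of \<open>kernel_sum_dilate\<close> with factor
  \<open>e + 1\<close>, since \<open>n + e < (e + 1) * (n + 1)\<close>.\<close>

lemma inverse_phi_lower:
  assumes "\<alpha> \<le> 1" "c > 0"
  obtains c' where "c' > 0"
    "\<And>n. n \<ge> 1 \<Longrightarrow> c' / phi \<alpha> (real (n + 1)) \<le> c / kernel_sum \<alpha> (n + e)"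
proof -
  obtain k where k: "k > 0" "\<And>N. N \<ge> 1 \<Longrightarrow> kernel_sum \<alpha> N \<le> k * phi \<alpha> (real (N + 1))"
    using kernel_sum_le_phi[OF assms(1)] by blast
  define D where "D = real (e + 1) * real (e + 1) powr \<bar>\<alpha>\<bar>"
  have D: "D > 0" by (simp add: D_def)
  show ?thesis
  proof (rule that[of "c / (D * k)"])
    show "c / (D * k) > 0" using assms(2) D k(1) by simp
    fix n :: nat assume n: "n \<ge> 1"
    have "kernel_sum \<alpha> (n + e) \<le> D * kernel_sum \<alpha> n"
      unfolding D_def by (rule kernel_sum_dilate) auto
    also have "\<dots> \<le> D * (k * phi \<alpha> (real (n + 1)))"
      using D k(2)[OF n] by (intro mult_left_mono) auto
    finally have "c / (D * (k * phi \<alpha> (real (n + 1)))) \<le> c / kernel_sum \<alpha> (n + e)"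
      using assms(2) D k(1) phi_pos[OF n, of \<alpha>] by (intro divide_left_mono) auto
    then show "c / (D * k) / phi \<alpha> (real (n + 1)) \<le> c / kernel_sum \<alpha> (n + e)"
      by (simp add: mult.assoc)
  qed
qed

text \<open>Restrict to the axis of the factor that vanishes on the circle; the other factor becomes
  a constant absorbed into the polynomial. The bound is uniform in \<open>P\<close> and so passes to
  the infimum.\<close>

lemma dist_one_lower:
  assumes "\<alpha> \<le> 1" "closed_disk_continuation g G" "closed_disk_continuation h H"
    and "\<forall>z\<in>ball 0 1. g z \<noteq> 0" "\<forall>z\<in>ball 0 1. h z \<noteq> 0"
    and "(\<exists>z\<in>sphere 0 1. G z = 0) \<or> (\<exists>z\<in>sphere 0 1. H z = 0)"
  shows "\<exists>c>0. \<forall>n\<ge>1. c / phi \<alpha> (real (n + 1)) \<le> (dist_one \<alpha> (\<lambda>z1 z2. g z1 * h z2) n)\<^sup>2"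
proof -
  obtain zs U V where "disk_factorization g G zs U V"
    using disk_factorization_exists[OF assms(2,4)] by blast
  then have g: "g has_fps_expansion fps_of_poly (zeros_poly zs) * U"
    "U * V = 1" "rapid_decay V" "rapid_decay (fps_of_poly (zeros_poly zs) * U)"
    and zs: "\<And>z. cmod z = 1 \<Longrightarrow> G z = 0 \<Longrightarrow>
      z \<in> set zs \<and> (\<exists>c. c \<noteq> 0 \<and> (\<lambda>k. fps_nth V k * z ^ k) sums c)"
    unfolding disk_factorization_def by simp_all
  obtain ws X Y where "disk_factorization h H ws X Y"
    using disk_factorization_exists[OF assms(3,5)] by blast
  then have h: "h has_fps_expansion fps_of_poly (zeros_poly ws) * X"
    "X * Y = 1" "rapid_decay Y" "rapid_decay (fps_of_poly (zeros_poly ws) * X)"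
    and ws: "\<And>z. cmod z = 1 \<Longrightarrow> H z = 0 \<Longrightarrow>
      z \<in> set ws \<and> (\<exists>c. c \<noteq> 0 \<and> (\<lambda>k. fps_nth Y k * z ^ k) sums c)"
    unfolding disk_factorization_def by simp_all
  note slice = bidisk_norm_ge_slice[OF assms(1) g(1) h(1) g(4) h(4)]
  have "\<exists>c e. c > 0 \<and> (\<forall>n. \<forall>P\<in>bidisk_polys n.
      c / kernel_sum \<alpha> (n + e) \<le> (bidisk_norm \<alpha> (\<lambda>z1 z2. P z1 z2 * (g z1 * h z2) - 1))\<^sup>2)"
    using assms(6)
  proof
    assume "\<exists>z\<in>sphere 0 1. G z = 0"
    then obtain z where z: "cmod z = 1" "G z = 0" by auto
    obtain c0 where c0: "c0 \<noteq> 0" "(\<lambda>k. fps_nth V k * z ^ k) sums c0"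
      using zs[OF z] by blast
    from dnorm_lower_bound[OF assms(1) g(2,3) z(1) zs[OF z, THEN conjunct1] c0(2,1)]
    obtain c e where "c > 0" and ce: "\<forall>n p B. degree p \<le> n \<longrightarrow>
      dnorm_bound \<alpha> (fps_of_poly p * (fps_of_poly (zeros_poly zs) * U) - 1) B \<longrightarrow>
      c / kernel_sum \<alpha> (n + e) \<le> B" by blast
    have "c / kernel_sum \<alpha> (n + e) \<le> (bidisk_norm \<alpha> (\<lambda>z1 z2. P z1 z2 * (g z1 * h z2) - 1))\<^sup>2"
      if "P \<in> bidisk_polys n" for n P
      using slice(1)[OF that] ce by blast
    with \<open>c > 0\<close> show ?thesis by blast
  next
    assume "\<exists>z\<in>sphere 0 1. H z = 0"
    then obtain z where z: "cmod z = 1" "H z = 0" by auto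
    obtain c0 where c0: "c0 \<noteq> 0" "(\<lambda>k. fps_nth Y k * z ^ k) sums c0"
      using ws[OF z] by blast
    from dnorm_lower_bound[OF assms(1) h(2,3) z(1) ws[OF z, THEN conjunct1] c0(2,1)]
    obtain c e where "c > 0" and ce: "\<forall>n p B. degree p \<le> n \<longrightarrow>
      dnorm_bound \<alpha> (fps_of_poly p * (fps_of_poly (zeros_poly ws) * X) - 1) B \<longrightarrow>
      c / kernel_sum \<alpha> (n + e) \<le> B" by blast
    have "c / kernel_sum \<alpha> (n + e) \<le> (bidisk_norm \<alpha> (\<lambda>z1 z2. P z1 z2 * (g z1 * h z2) - 1))\<^sup>2"
      if "P \<in> bidisk_polys n" for n P
      using slice(2)[OF that] ce by blast
    with \<open>c > 0\<close> show ?thesis by blast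
  qed
  then obtain c e where ce: "c > 0" "\<And>n P. P \<in> bidisk_polys n \<Longrightarrow>
      c / kernel_sum \<alpha> (n + e) \<le> (bidisk_norm \<alpha> (\<lambda>z1 z2. P z1 z2 * (g z1 * h z2) - 1))\<^sup>2"
    by blast
  obtain c' where c': "c' > 0"
    "\<And>n. n \<ge> 1 \<Longrightarrow> c' / phi \<alpha> (real (n + 1)) \<le> c / kernel_sum \<alpha> (n + e)"
    using inverse_phi_lower[OF assms(1) ce(1)] by blast
  have "c / kernel_sum \<alpha> (n + e) \<le> (dist_one \<alpha> (\<lambda>z1 z2. g z1 * h z2) n)\<^sup>2" for n
    using ce by (intro dist_one_square_ge) auto
  with c' show ?thesis by (meson order_trans)
qed

lemma dist_one_upper:
  assumes "\<alpha> \<le> 1" "closed_disk_continuation g G" "closed_disk_continuation h H"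
    and "\<forall>z\<in>ball 0 1. g z \<noteq> 0" "\<forall>z\<in>ball 0 1. h z \<noteq> 0"
  shows "\<exists>C N. \<forall>n\<ge>N. (dist_one \<alpha> (\<lambda>z1 z2. g z1 * h z2) n)\<^sup>2 \<le> C / phi \<alpha> (real (n + 1))"
proof -
  obtain F B d where g: "g has_fps_expansion F" "B \<ge> 0"
    "\<forall>N. \<exists>p. degree p \<le> d * N \<and> dnorm_bound \<alpha> (fps_of_poly p * F - 1) (B / kernel_sum \<alpha> N)"
    using one_variable_upper[OF assms(1,2,4)] by blast
  obtain F' B' d' where h: "h has_fps_expansion F'" "B' \<ge> 0"
    "\<forall>N. \<exists>p. degree p \<le> d' * N \<and> dnorm_bound \<alpha> (fps_of_poly p * F' - 1) (B' / kernel_sum \<alpha> N)"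
    using one_variable_upper[OF assms(1,3,5)] by blast
  obtain k where k: "k > 0" "\<And>N. phi \<alpha> (real (N + 1)) \<le> k * kernel_sum \<alpha> N"
    using phi_le_kernel_sum[OF assms(1)] by blast
  \<comment> \<open>The summand 1 makes \<open>m\<close> positive, as division by \<open>m\<close>
    requires.\<close>
  define m where "m = d + d' + 1"
  define D where "D = real m * real m powr \<bar>\<alpha>\<bar>"
  define E where "E = 3 * (B * B' + B + B')"
  have E: "E \<ge> 0" using g(2) h(2) by (simp add: E_def)
  have "(dist_one \<alpha> (\<lambda>z1 z2. g z1 * h z2) n)\<^sup>2 \<le> E * k * D / phi \<alpha> (real (n + 1))" if "n \<ge> 1" for n
  proof -
    \<comment> \<open>Then \<open>d * N\<close> and \<open>d' * N\<close> are at most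
      \<open>n\<close>, while \<open>n < m * (N + 1)\<close> lets dilation recover
      \<open>kernel_sum \<alpha> n\<close> up to the factor \<open>D\<close>.\<close>
    define N where "N = n div m"
    let ?S = "kernel_sum \<alpha> N"
    have mN: "m * N \<le> n" by (simp add: N_def)
    obtain p where p: "degree p \<le> d * N" "dnorm_bound \<alpha> (fps_of_poly p * F - 1) (B / ?S)"
      using g(3) by blast
    obtain q where q: "degree q \<le> d' * N" "dnorm_bound \<alpha> (fps_of_poly q * F' - 1) (B' / ?S)"
      using h(3) by blast
    have "degree p \<le> n" "degree q \<le> n"
      using p(1) q(1) mN by (simp_all add: m_def distrib_right)
    then have "(dist_one \<alpha> (\<lambda>z1 z2. g z1 * h z2) n)\<^sup>2
        \<le> 3 * ((B / ?S) * (B' / ?S) + B / ?S + B' / ?S)"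
      using bidisk_norm_product_le[OF g(1) h(1) _ p(2) _ q(2)] by blast
    \<comment> \<open>The product of the two errors is of second order; \<open>?S \<ge> 1\<close>
      reduces it to first order.\<close>
    also have "(B / ?S) * (B' / ?S) \<le> (B / ?S) * (B' / 1)"
      using g(2) h(2) kernel_sum_ge_1[of \<alpha> N] by (intro mult_left_mono divide_left_mono) auto
    also have "3 * ((B / ?S) * (B' / 1) + B / ?S + B' / ?S) = E / ?S"
      by (simp add: E_def add_divide_distrib)
    also have "E / ?S \<le> E * k * D / phi \<alpha> (real (n + 1))"
    proof -
      have "n < m * (N + 1)"
        using dividend_less_times_div[of m n] unfolding N_def by (simp add: m_def)
      then have "kernel_sum \<alpha> n \<le> D * ?S"
        unfolding D_def by (intro kernel_sum_dilate) (auto simp: m_def)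
      then have "phi \<alpha> (real (n + 1)) \<le> k * (D * ?S)"
        using k(1) by (intro order_trans[OF k(2)] mult_left_mono) auto
      then have "E * phi \<alpha> (real (n + 1)) \<le> E * (k * (D * ?S))"
        using E by (intro mult_left_mono) auto
      then show ?thesis
        using phi_pos[OF that, of \<alpha>] by (simp add: field_simps)
    qed
    finally show ?thesis by simp
  qed
  then show ?thesis by blast
qed

theorem theorem2p6:
  fixes \<alpha> :: real and g h G H :: "complex \<Rightarrow> complex"
    and f :: "complex \<Rightarrow> complex \<Rightarrow> complex"
  assumes "\<alpha> \<le> 1"
    and "g \<in> dirichlet_space \<alpha>" and "h \<in> dirichlet_space \<alpha>"
    and "closed_disk_continuation g G" and "closed_disk_continuation h H"
    and "\<forall>z\<in>ball 0 1. g z \<noteq> 0" and "\<forall>z\<in>ball 0 1. h z \<noteq> 0"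
    and "f = (\<lambda>z1 z2. g z1 * h z2)"
  shows "(\<exists>C. \<exists>N. \<forall>n\<ge>N. (dist_one \<alpha> f n)\<^sup>2 \<le> C / phi \<alpha> (real (n + 1)))
    \<and> (((\<exists>z\<in>sphere 0 1. H z = 0) \<and> (\<forall>z\<in>cball 0 1. G z \<noteq> 0)
         \<or> (\<exists>z\<in>sphere 0 1. G z = 0) \<and> (\<forall>z\<in>cball 0 1. H z \<noteq> 0))
        \<longrightarrow> (\<exists>C'>0. \<forall>n\<ge>1. C' / phi \<alpha> (real (n + 1)) \<le> (dist_one \<alpha> f n)\<^sup>2))"
  using dist_one_upper[OF assms(1,4-7)] dist_one_lower[OF assms(1,4-7)]
  unfolding assms(8) by blast

end
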